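(* Let $(\mathsf{R},\otimes,\mathbf{1})$ be an essentially small monoidal triangulated category, with tensor product exact in each variable (not assumed symmetric or braided). Suppose that every $2$-sided thick $\otimes$-ideal of $\mathsf{R}$ is semiprime. Then the noncommutative Balmer spectrum $\mathrm{Spc}^{\mathrm{nc}}\,\mathsf{R}$ is given by $$\mathrm{Spc}^{\mathrm{nc}}\,\mathsf{R}=D\,\mathrm{Spec}(\Omega T^\otimes(\mathsf{R}))=D\,\mathsf{CLat}(T^\otimes(\mathsf{R}),\mathbf{2}),$$ where points of $\mathsf{CLat}(T^\otimes(\mathsf{R}),\mathbf{2})$ are identified with meet-prime elements of $T^\otimes(\mathsf{R})$.
   Context: A $2$-sided thick $\otimes$-ideal is a thick subcategory (full, closed under isomorphisms, suspensions, cones, direct summands) closed under tensoring on the left and on the right with arbitrary objects of $\mathsf{R}$. Such an ideal $\mathsf{J}$ is semiprime if, for $r\in\mathsf{R}$, $r\otimes s\otimes r\in\mathsf{J}$ for all $s\in\mathsf{R}$ implies $r\in\mathsf{J}$. $T^\otimes(\mathsf{R})$ is the complete lattice of semiprime $2$-sided thick $\otimes$-ideals ordered by inclusion, with meets given by intersection. A proper $2$-sided thick $\otimes$-ideal $\mathsf{P}$ is prime if for all $2$-sided thick $\otimes$-ideals $\mathsf{I},\mathsf{J}$, $\mathsf{I}\otimes\mathsf{J}\subseteq\mathsf{P}$ implies $\mathsf{I}\subseteq\mathsf{P}$ or $\mathsf{J}\subseteq\mathsf{P}$. The noncommutative Balmer spectrum $\mathrm{Spc}^{\mathrm{nc}}\,\mathsf{R}$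 (of Nakano–Vashaw–Yakimov) is the set of prime $2$-sided thick $\otimes$-ideals, with closed subsets $\{\mathsf{P}\mid\mathsf{P}\cap\mathcal{S}=\varnothing\}$ for collections $\mathcal{S}$ of objects of $\mathsf{R}$. $\mathbf{2}=\{0\le1\}$. For a complete lattice $L$, $\mathsf{CLat}(L,\mathbf{2})$ is the set of poset maps $L\to\mathbf{2}$ preserving finite meets and arbitrary joins, topologized with opens $U_l=\{p\mid p(l)=1\}$ for $l\in L$. It corresponds to the set of meet-prime elements ($\mathfrak{p}\neq1$ with $l\wedge m\le\mathfrak{p}\Rightarrow l\le\mathfrak{p}$ or $m\le\mathfrak{p}$) via $p(a)=0\iff a\le\mathfrak{p}$. $\Omega L$ is the frame of open subsets of $\mathsf{CLat}(L,\mathbf{2})$. For a frame $F$, $\mathrm{Spec}\,F=\mathsf{CLat}(F,\mathbf{2})$; since $\mathsf{CLat}(L,\mathbf{2})$ is sober, $\mathrm{Spec}\,\Omega L\cong\mathsf{CLat}(L,\mathbf{2})$ canonically. For a space $X$ of this kind, $DX$ is the same set with the topology whose closed subsets are generated by the quasi-compact open subsets of $X$. *)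

theory Defs
  imports "HOL-Algebra.Group" "HOL-Algebra.Complete_Lattice" "HOL-Analysis.Abstract_Topology"
begin

section \<open>Categories\<close>

record ('o, 'm) category_data =
  Obj :: "'o set"
  Mor :: "'m set"
  Dom :: "'m \<Rightarrow> 'o"
  Cod :: "'m \<Rightarrow> 'o"
  Ident :: "'o \<Rightarrow> 'm"
  Comp :: "'m \<Rightarrow> 'm \<Rightarrow> 'm" (infixr \<open>\<cdot>\<index>\<close> 70)

definition Hom :: "('o, 'm, 'x) category_data_scheme \<Rightarrow> 'o \<Rightarrow> 'o \<Rightarrow> 'm set" where
  "Hom C X Y = {f \<in> Mor C. Dom C f = X \<and> Cod C f = Y}"

text \<open>The objects form a set and so do the morphisms, as always in HOL; no separate hypothesis
  expresses essential smallness.\<close>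

locale category =
  fixes C :: "('o, 'm, 'x) category_data_scheme" (structure)
  assumes Dom_closed: "f \<in> Mor C \<Longrightarrow> Dom C f \<in> Obj C"
    and Cod_closed: "f \<in> Mor C \<Longrightarrow> Cod C f \<in> Obj C"
    and Ident_closed: "X \<in> Obj C \<Longrightarrow> Ident C X \<in> Hom C X X"
    and Comp_closed: "\<lbrakk>f \<in> Hom C X Y; g \<in> Hom C Y Z\<rbrakk> \<Longrightarrow> g \<cdot> f \<in> Hom C X Z"
    and Comp_assoc: "\<lbrakk>f \<in> Hom C W X; g \<in> Hom C X Y; h \<in> Hom C Y Z\<rbrakk>
        \<Longrightarrow> (h \<cdot> g) \<cdot> f = h \<cdot> (g \<cdot> f)"
    and Comp_Ident_left: "f \<in> Hom C X Y \<Longrightarrow> Ident C Y \<cdot> f = f"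
    and Comp_Ident_right: "f \<in> Hom C X Y \<Longrightarrow> f \<cdot> Ident C X = f"

definition is_iso :: "('o, 'm, 'x) category_data_scheme \<Rightarrow> 'o \<Rightarrow> 'o \<Rightarrow> 'm \<Rightarrow> bool" where
  "is_iso C X Y f \<longleftrightarrow> f \<in> Hom C X Y \<and>
     (\<exists>g \<in> Hom C Y X. g \<cdot>\<^bsub>C\<^esub> f = Ident C X \<and> f \<cdot>\<^bsub>C\<^esub> g = Ident C Y)"

definition isomorphic :: "('o, 'm, 'x) category_data_scheme \<Rightarrow> 'o \<Rightarrow> 'o \<Rightarrow> bool" where
  "isomorphic C X Y \<longleftrightarrow> (\<exists>f. is_iso C X Y f)"

definition is_functor ::
  "('o, 'm, 'x) category_data_scheme \<Rightarrow> ('p, 'n, 'y) category_data_scheme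
    \<Rightarrow> ('o \<Rightarrow> 'p) \<Rightarrow> ('m \<Rightarrow> 'n) \<Rightarrow> bool" where
  "is_functor C D FO FM \<longleftrightarrow>
     (\<forall>X \<in> Obj C. FO X \<in> Obj D) \<and>
     (\<forall>X \<in> Obj C. \<forall>Y \<in> Obj C. \<forall>f \<in> Hom C X Y. FM f \<in> Hom D (FO X) (FO Y)) \<and>
     (\<forall>X \<in> Obj C. FM (Ident C X) = Ident D (FO X)) \<and>
     (\<forall>X \<in> Obj C. \<forall>Y \<in> Obj C. \<forall>Z \<in> Obj C. \<forall>f \<in> Hom C X Y. \<forall>g \<in> Hom C Y Z.
        FM (g \<cdot>\<^bsub>C\<^esub> f) = FM g \<cdot>\<^bsub>D\<^esub> FM f)"

definition is_equivalence ::
  "('o, 'm, 'x) category_data_scheme \<Rightarrow> ('p, 'n, 'y) category_data_scheme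
    \<Rightarrow> ('o \<Rightarrow> 'p) \<Rightarrow> ('m \<Rightarrow> 'n) \<Rightarrow> bool" where
  "is_equivalence C D FO FM \<longleftrightarrow> is_functor C D FO FM \<and>
     (\<forall>X \<in> Obj C. \<forall>Y \<in> Obj C. bij_betw FM (Hom C X Y) (Hom D (FO X) (FO Y))) \<and>
     (\<forall>B \<in> Obj D. \<exists>X \<in> Obj C. isomorphic D (FO X) B)"

definition is_natural_iso ::
  "('o, 'm, 'x) category_data_scheme \<Rightarrow> ('p, 'n, 'y) category_data_scheme
    \<Rightarrow> ('o \<Rightarrow> 'p) \<Rightarrow> ('m \<Rightarrow> 'n) \<Rightarrow> ('o \<Rightarrow> 'p) \<Rightarrow> ('m \<Rightarrow> 'n) \<Rightarrow> ('o \<Rightarrow> 'n) \<Rightarrow> bool" where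
  "is_natural_iso C D FO FM GO GM \<theta> \<longleftrightarrow>
     (\<forall>X \<in> Obj C. is_iso D (FO X) (GO X) (\<theta> X)) \<and>
     (\<forall>X \<in> Obj C. \<forall>Y \<in> Obj C. \<forall>f \<in> Hom C X Y. GM f \<cdot>\<^bsub>D\<^esub> \<theta> X = \<theta> Y \<cdot>\<^bsub>D\<^esub> FM f)"


section \<open>Additive categories\<close>

record ('o, 'm) additive_data = "('o, 'm) category_data" +
  Plus :: "'m \<Rightarrow> 'm \<Rightarrow> 'm"
  ZeroMor :: "'o \<Rightarrow> 'o \<Rightarrow> 'm"

definition hom_group :: "('o, 'm, 'x) additive_data_scheme \<Rightarrow> 'o \<Rightarrow> 'o \<Rightarrow> 'm monoid" where
  "hom_group C X Y = \<lparr>carrier = Hom C X Y, mult = Plus C, one = ZeroMor C X Y\<rparr>"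

definition Neg :: "('o, 'm, 'x) additive_data_scheme \<Rightarrow> 'm \<Rightarrow> 'm" where
  "Neg C f = inv\<^bsub>hom_group C (Dom C f) (Cod C f)\<^esub> f"

definition is_zero_object :: "('o, 'm, 'x) category_data_scheme \<Rightarrow> 'o \<Rightarrow> bool" where
  "is_zero_object C Z \<longleftrightarrow> Z \<in> Obj C \<and>
     (\<forall>X \<in> Obj C. (\<exists>!f. f \<in> Hom C X Z) \<and> (\<exists>!f. f \<in> Hom C Z X))"

definition is_biproduct :: "('o, 'm, 'x) additive_data_scheme \<Rightarrow> 'o \<Rightarrow> 'o \<Rightarrow> 'o \<Rightarrow> bool" where
  "is_biproduct C X Y B \<longleftrightarrow> X \<in> Obj C \<and> Y \<in> Obj C \<and> B \<in> Obj C \<and>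
     (\<exists>i \<in> Hom C X B. \<exists>j \<in> Hom C Y B. \<exists>p \<in> Hom C B X. \<exists>q \<in> Hom C B Y.
        p \<cdot>\<^bsub>C\<^esub> i = Ident C X \<and> q \<cdot>\<^bsub>C\<^esub> j = Ident C Y \<and>
        p \<cdot>\<^bsub>C\<^esub> j = ZeroMor C Y X \<and> q \<cdot>\<^bsub>C\<^esub> i = ZeroMor C X Y \<and>
        Plus C (i \<cdot>\<^bsub>C\<^esub> p) (j \<cdot>\<^bsub>C\<^esub> q) = Ident C B)"

locale additive_category = category C
  for C :: "('o, 'm, 'x) additive_data_scheme" (structure) +
  assumes hom_comm_group: "\<lbrakk>X \<in> Obj C; Y \<in> Obj C\<rbrakk> \<Longrightarrow> comm_group (hom_group C X Y)"
    and Comp_Plus_left: "\<lbrakk>f \<in> Hom C X Y; g \<in> Hom C Y Z; g' \<in> Hom C Y Z\<rbrakk>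
        \<Longrightarrow> Plus C g g' \<cdot> f = Plus C (g \<cdot> f) (g' \<cdot> f)"
    and Comp_Plus_right: "\<lbrakk>f \<in> Hom C X Y; f' \<in> Hom C X Y; g \<in> Hom C Y Z\<rbrakk>
        \<Longrightarrow> g \<cdot> Plus C f f' = Plus C (g \<cdot> f) (g \<cdot> f')"
    and ex_zero_object: "\<exists>Z. is_zero_object C Z"
    and ex_biproduct: "\<lbrakk>X \<in> Obj C; Y \<in> Obj C\<rbrakk> \<Longrightarrow> \<exists>B. is_biproduct C X Y B"

definition is_additive_functor ::
  "('o, 'm, 'x) additive_data_scheme \<Rightarrow> ('p, 'n, 'y) additive_data_scheme
    \<Rightarrow> ('o \<Rightarrow> 'p) \<Rightarrow> ('m \<Rightarrow> 'n) \<Rightarrow> bool" where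
  "is_additive_functor C D FO FM \<longleftrightarrow> is_functor C D FO FM \<and>
     (\<forall>X \<in> Obj C. \<forall>Y \<in> Obj C. \<forall>f \<in> Hom C X Y. \<forall>g \<in> Hom C X Y.
        FM (Plus C f g) = Plus D (FM f) (FM g))"


section \<open>Triangulated categories\<close>

text \<open>\<open>(f, g, h) \<in> Dist C\<close> means that \<open>X \<rightarrow> Y \<rightarrow> Z \<rightarrow> \<Sigma>X\<close>, with maps \<open>f\<close>, \<open>g\<close>, \<open>h\<close>, is a
  distinguished triangle.\<close>

record ('o, 'm) triangulated_data = "('o, 'm) additive_data" +
  Susp :: "'o \<Rightarrow> 'o"
  SuspMor :: "'m \<Rightarrow> 'm"
  Dist :: "('m \<times> 'm \<times> 'm) set"

definition is_triangle ::
  "('o, 'm, 'x) triangulated_data_scheme \<Rightarrow> 'o \<Rightarrow> 'o \<Rightarrow> 'o \<Rightarrow> 'm \<Rightarrow> 'm \<Rightarrow> 'm \<Rightarrow> bool" where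
  "is_triangle C X Y Z f g h \<longleftrightarrow>
     f \<in> Hom C X Y \<and> g \<in> Hom C Y Z \<and> h \<in> Hom C Z (Susp C X)"

definition is_dist_triangle ::
  "('o, 'm, 'x) triangulated_data_scheme \<Rightarrow> 'o \<Rightarrow> 'o \<Rightarrow> 'o \<Rightarrow> 'm \<Rightarrow> 'm \<Rightarrow> 'm \<Rightarrow> bool" where
  "is_dist_triangle C X Y Z f g h \<longleftrightarrow> is_triangle C X Y Z f g h \<and> (f, g, h) \<in> Dist C"

locale triangulated_category = additive_category C
  for C :: "('o, 'm, 'x) triangulated_data_scheme" (structure) +
  assumes Susp_additive: "is_additive_functor C C (Susp C) (SuspMor C)"
    and Susp_equivalence: "is_equivalence C C (Susp C) (SuspMor C)"
    and Dist_triangle: "(f, g, h) \<in> Dist C \<Longrightarrow> \<exists>X Y Z. is_triangle C X Y Z f g h"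
    and TR1_iso: "\<lbrakk>is_dist_triangle C X Y Z f g h; is_triangle C X' Y' Z' f' g' h';
          is_iso C X X' a; is_iso C Y Y' b; is_iso C Z Z' c;
          b \<cdot> f = f' \<cdot> a; c \<cdot> g = g' \<cdot> b; SuspMor C a \<cdot> h = h' \<cdot> c\<rbrakk>
        \<Longrightarrow> is_dist_triangle C X' Y' Z' f' g' h'"
    and TR1_Ident: "\<lbrakk>X \<in> Obj C; is_zero_object C Z\<rbrakk>
        \<Longrightarrow> is_dist_triangle C X X Z (Ident C X) (ZeroMor C X Z) (ZeroMor C Z (Susp C X))"
    and TR1_cone: "f \<in> Hom C X Y \<Longrightarrow> \<exists>Z g h. is_dist_triangle C X Y Z f g h"
    and TR2: "is_triangle C X Y Z f g h \<Longrightarrow>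
        is_dist_triangle C X Y Z f g h \<longleftrightarrow>
        is_dist_triangle C Y Z (Susp C X) g h (Neg C (SuspMor C f))"
    and TR3: "\<lbrakk>is_dist_triangle C X Y Z f g h; is_dist_triangle C X' Y' Z' f' g' h';
          a \<in> Hom C X X'; b \<in> Hom C Y Y'; b \<cdot> f = f' \<cdot> a\<rbrakk>
        \<Longrightarrow> \<exists>c \<in> Hom C Z Z'. c \<cdot> g = g' \<cdot> b \<and> SuspMor C a \<cdot> h = h' \<cdot> c"
    and TR4: "\<lbrakk>is_dist_triangle C X Y Z' f i i'; is_dist_triangle C Y Z X' g j j';
          is_dist_triangle C X Z Y' (g \<cdot> f) k k'\<rbrakk>
        \<Longrightarrow> \<exists>u v. is_dist_triangle C Z' Y' X' u v (SuspMor C i \<cdot> j') \<and>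
              k \<cdot> g = u \<cdot> i \<and> k' \<cdot> u = i' \<and> v \<cdot> k = j \<and> j' \<cdot> v = SuspMor C f \<cdot> k'"

definition is_exact_functor ::
  "('o, 'm, 'x) triangulated_data_scheme \<Rightarrow> ('p, 'n, 'y) triangulated_data_scheme
    \<Rightarrow> ('o \<Rightarrow> 'p) \<Rightarrow> ('m \<Rightarrow> 'n) \<Rightarrow> bool" where
  "is_exact_functor C D FO FM \<longleftrightarrow> is_additive_functor C D FO FM \<and>
     (\<exists>\<theta>. is_natural_iso C D (\<lambda>X. FO (Susp C X)) (\<lambda>f. FM (SuspMor C f))
                             (\<lambda>X. Susp D (FO X)) (\<lambda>f. SuspMor D (FM f)) \<theta> \<and>
          (\<forall>X Y Z f g h. is_dist_triangle C X Y Z f g h \<longrightarrow>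
             is_dist_triangle D (FO X) (FO Y) (FO Z) (FM f) (FM g) (\<theta> X \<cdot>\<^bsub>D\<^esub> FM h)))"


section \<open>Monoidal triangulated categories\<close>

record ('o, 'm) monoidal_triangulated_data = "('o, 'm) triangulated_data" +
  Tens :: "'o \<Rightarrow> 'o \<Rightarrow> 'o" (infixl \<open>\<odot>\<index>\<close> 75)
  TensMor :: "'m \<Rightarrow> 'm \<Rightarrow> 'm" (infixl \<open>\<odot>\<^sub>m\<index>\<close> 75)
  TUnit :: "'o"
  Assoc :: "'o \<Rightarrow> 'o \<Rightarrow> 'o \<Rightarrow> 'm"
  LUnit :: "'o \<Rightarrow> 'm"
  RUnit :: "'o \<Rightarrow> 'm"

locale monoidal_triangulated_category = triangulated_category C
  for C :: "('o, 'm, 'x) monoidal_triangulated_data_scheme" (structure) +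
  assumes TUnit_closed: "TUnit C \<in> Obj C"
    and Tens_closed: "\<lbrakk>X \<in> Obj C; Y \<in> Obj C\<rbrakk> \<Longrightarrow> X \<odot> Y \<in> Obj C"
    and TensMor_closed: "\<lbrakk>f \<in> Hom C X X'; g \<in> Hom C Y Y'\<rbrakk>
        \<Longrightarrow> f \<odot>\<^sub>m g \<in> Hom C (X \<odot> Y) (X' \<odot> Y')"
    and TensMor_Ident: "\<lbrakk>X \<in> Obj C; Y \<in> Obj C\<rbrakk>
        \<Longrightarrow> Ident C X \<odot>\<^sub>m Ident C Y = Ident C (X \<odot> Y)"
    and TensMor_Comp: "\<lbrakk>f \<in> Hom C X X'; f' \<in> Hom C X' X''; g \<in> Hom C Y Y'; g' \<in> Hom C Y' Y''\<rbrakk>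
        \<Longrightarrow> (f' \<cdot> f) \<odot>\<^sub>m (g' \<cdot> g) = (f' \<odot>\<^sub>m g') \<cdot> (f \<odot>\<^sub>m g)"
    and Assoc_iso: "\<lbrakk>X \<in> Obj C; Y \<in> Obj C; Z \<in> Obj C\<rbrakk>
        \<Longrightarrow> is_iso C ((X \<odot> Y) \<odot> Z) (X \<odot> (Y \<odot> Z)) (Assoc C X Y Z)"
    and Assoc_natural: "\<lbrakk>f \<in> Hom C X X'; g \<in> Hom C Y Y'; h \<in> Hom C Z Z'\<rbrakk>
        \<Longrightarrow> (f \<odot>\<^sub>m (g \<odot>\<^sub>m h)) \<cdot> Assoc C X Y Z = Assoc C X' Y' Z' \<cdot> ((f \<odot>\<^sub>m g) \<odot>\<^sub>m h)"
    and LUnit_iso: "X \<in> Obj C \<Longrightarrow> is_iso C (TUnit C \<odot> X) X (LUnit C X)"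
    and LUnit_natural: "f \<in> Hom C X Y
        \<Longrightarrow> f \<cdot> LUnit C X = LUnit C Y \<cdot> (Ident C (TUnit C) \<odot>\<^sub>m f)"
    and RUnit_iso: "X \<in> Obj C \<Longrightarrow> is_iso C (X \<odot> TUnit C) X (RUnit C X)"
    and RUnit_natural: "f \<in> Hom C X Y
        \<Longrightarrow> f \<cdot> RUnit C X = RUnit C Y \<cdot> (f \<odot>\<^sub>m Ident C (TUnit C))"
    and pentagon: "\<lbrakk>W \<in> Obj C; X \<in> Obj C; Y \<in> Obj C; Z \<in> Obj C\<rbrakk>
        \<Longrightarrow> Assoc C W X (Y \<odot> Z) \<cdot> Assoc C (W \<odot> X) Y Z =
            (Ident C W \<odot>\<^sub>m Assoc C X Y Z) \<cdot> (Assoc C W (X \<odot> Y) Z \<cdot> (Assoc C W X Y \<odot>\<^sub>m Ident C Z))"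
    and unit_triangle: "\<lbrakk>X \<in> Obj C; Y \<in> Obj C\<rbrakk>
        \<Longrightarrow> (Ident C X \<odot>\<^sub>m LUnit C Y) \<cdot> Assoc C X (TUnit C) Y = RUnit C X \<odot>\<^sub>m Ident C Y"
    and Tens_exact_right: "A \<in> Obj C
        \<Longrightarrow> is_exact_functor C C (\<lambda>X. A \<odot> X) (\<lambda>f. Ident C A \<odot>\<^sub>m f)"
    and Tens_exact_left: "A \<in> Obj C
        \<Longrightarrow> is_exact_functor C C (\<lambda>X. X \<odot> A) (\<lambda>f. f \<odot>\<^sub>m Ident C A)"


section \<open>Thick tensor ideals\<close>

text \<open>A full subcategory is given by its set of objects. A thick subcategory is a triangulated
  subcategory, hence contains the zero objects and is closed under desuspension as well.\<close>

definition thick_subcategory :: "('o, 'm, 'x) triangulated_data_scheme \<Rightarrow> 'o set \<Rightarrow> bool" where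
  "thick_subcategory C J \<longleftrightarrow> J \<subseteq> Obj C \<and>
     (\<forall>Z. is_zero_object C Z \<longrightarrow> Z \<in> J) \<and>
     (\<forall>X \<in> J. \<forall>Y \<in> Obj C. isomorphic C X Y \<longrightarrow> Y \<in> J) \<and>
     (\<forall>X \<in> Obj C. Susp C X \<in> J \<longleftrightarrow> X \<in> J) \<and>
     (\<forall>X Y Z f g h. is_dist_triangle C X Y Z f g h \<and> X \<in> J \<and> Y \<in> J \<longrightarrow> Z \<in> J) \<and>
     (\<forall>X Y B. is_biproduct C X Y B \<and> B \<in> J \<longrightarrow> X \<in> J)"

definition thick_tensor_ideal ::
  "('o, 'm, 'x) monoidal_triangulated_data_scheme \<Rightarrow> 'o set \<Rightarrow> bool" where
  "thick_tensor_ideal C J \<longleftrightarrow> thick_subcategory C J \<and>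
     (\<forall>X \<in> Obj C. \<forall>Y \<in> J. X \<odot>\<^bsub>C\<^esub> Y \<in> J \<and> Y \<odot>\<^bsub>C\<^esub> X \<in> J)"

definition semiprime_ideal ::
  "('o, 'm, 'x) monoidal_triangulated_data_scheme \<Rightarrow> 'o set \<Rightarrow> bool" where
  "semiprime_ideal C J \<longleftrightarrow> thick_tensor_ideal C J \<and>
     (\<forall>r \<in> Obj C. (\<forall>s \<in> Obj C. r \<odot>\<^bsub>C\<^esub> s \<odot>\<^bsub>C\<^esub> r \<in> J) \<longrightarrow> r \<in> J)"

definition prime_ideal ::
  "('o, 'm, 'x) monoidal_triangulated_data_scheme \<Rightarrow> 'o set \<Rightarrow> bool" where
  "prime_ideal C P \<longleftrightarrow> thick_tensor_ideal C P \<and> P \<noteq> Obj C \<and>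
     (\<forall>I J. thick_tensor_ideal C I \<and> thick_tensor_ideal C J \<and> {a \<odot>\<^bsub>C\<^esub> b | a b. a \<in> I \<and> b \<in> J} \<subseteq> P
        \<longrightarrow> I \<subseteq> P \<or> J \<subseteq> P)"

definition semiprime_lattice ::
  "('o, 'm, 'x) monoidal_triangulated_data_scheme \<Rightarrow> 'o set gorder" where
  "semiprime_lattice C = \<lparr>carrier = {J. semiprime_ideal C J}, eq = (=), le = (\<subseteq>)\<rparr>"

definition Spc_nc :: "('o, 'm, 'x) monoidal_triangulated_data_scheme \<Rightarrow> 'o set topology" where
  "Spc_nc C = topology (\<lambda>U. \<exists>S \<subseteq> Obj C.
     U = {P. prime_ideal C P} - {P. prime_ideal C P \<and> P \<inter> S = {}})"


section \<open>Points of complete lattices\<close>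

definition CLat :: "'a gorder \<Rightarrow> 'b gorder \<Rightarrow> ('a \<Rightarrow> 'b) set" where
  "CLat L M = {p \<in> carrier L \<rightarrow>\<^sub>E carrier M.
     isotone L M p \<and> sup_pres L M p \<and>
     (\<forall>A \<subseteq> carrier L. finite A \<longrightarrow> p (\<Sqinter>\<^bsub>L\<^esub>A) = \<Sqinter>\<^bsub>M\<^esub>(p ` A))}"

text \<open>The lattice \<open>{0 \<le> 1}\<close>, with 0 the value \<open>False\<close> and 1 the value \<open>True\<close>.\<close>

definition two :: "bool gorder" where
  "two = \<lparr>carrier = UNIV, eq = (=), le = (\<le>)\<rparr>"

definition point_space :: "'a gorder \<Rightarrow> ('a \<Rightarrow> bool) topology" where
  "point_space L = topology (\<lambda>U. \<exists>l \<in> carrier L. U = {p \<in> CLat L two. p l = True})"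

definition opens :: "'a topology \<Rightarrow> 'a set gorder" where
  "opens X = \<lparr>carrier = {U. openin X U}, eq = (=), le = (\<subseteq>)\<rparr>"

definition Omega :: "'a gorder \<Rightarrow> ('a \<Rightarrow> bool) set gorder" where
  "Omega L = opens (point_space L)"

text \<open>For a frame, \<open>point_space\<close> is its spectrum.\<close>

abbreviation (input) Spec :: "'a gorder \<Rightarrow> ('a \<Rightarrow> bool) topology" where
  "Spec F \<equiv> point_space F"

text \<open>The canonical map from a space \<open>X\<close> to \<open>Spec (opens X)\<close>.\<close>

definition point_eval :: "'a topology \<Rightarrow> 'a \<Rightarrow> 'a set \<Rightarrow> bool" where
  "point_eval X x = restrict (\<lambda>U. x \<in> U) {U. openin X U}"

definition meet_prime :: "'a gorder \<Rightarrow> 'a \<Rightarrow> bool" where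
  "meet_prime L x \<longleftrightarrow> x \<in> carrier L \<and> x \<noteq> \<top>\<^bsub>L\<^esub> \<and>
     (\<forall>l \<in> carrier L. \<forall>m \<in> carrier L. l \<sqinter>\<^bsub>L\<^esub> m \<sqsubseteq>\<^bsub>L\<^esub> x \<longrightarrow> l \<sqsubseteq>\<^bsub>L\<^esub> x \<or> m \<sqsubseteq>\<^bsub>L\<^esub> x)"

text \<open>The map \<open>p\<close> with \<open>p a = 0\<close> iff \<open>a\<close> lies below \<open>x\<close>.\<close>

definition point_of :: "'a gorder \<Rightarrow> 'a \<Rightarrow> 'a \<Rightarrow> bool" where
  "point_of L x = restrict (\<lambda>a. \<not> a \<sqsubseteq>\<^bsub>L\<^esub> x) (carrier L)"

text \<open>The same set, with the topology whose closed sets are generated by the quasi-compact opens.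
  The empty set is a quasi-compact open, so the underlying set is indeed unchanged.\<close>

definition dual_space :: "'a topology \<Rightarrow> 'a topology" where
  "dual_space X = topology_generated_by {topspace X - K | K. openin X K \<and> compactin X K}"


section \<open>Well-definedness\<close>

lemma least_two: "least two (True \<in> A) (Upper two A)"
  unfolding least_def Upper_def two_def by simp (metis (full_types))

lemma greatest_two: "greatest two (False \<notin> A) (Lower two A)"
  unfolding greatest_def Lower_def two_def by simp (metis (full_types))

lemma complete_lattice_two: "complete_lattice two"
proof -
  interpret partial_order two
    by standard (auto simp: two_def)
  show ?thesis
    by (rule complete_latticeI) (use least_two greatest_two in blast)+
qed

lemma complete_lattice_opens: "complete_lattice (opens X)"
proof -
  interpret partial_order "opens X"
    by standard (auto simp: opens_def)
  show ?thesis
  proof (rule complete_latticeI)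
    fix A assume A: "A \<subseteq> carrier (opens X)"
    show "\<exists>s. least (opens X) s (Upper (opens X) A)"
      using A by (intro exI[of _ "\<Union>A"]) (auto simp: least_def Upper_def opens_def)
    show "\<exists>i. greatest (opens X) i (Lower (opens X) A)"
      using A by (intro exI[of _ "\<Union>{U. openin X U \<and> (\<forall>V \<in> A. U \<subseteq> V)}"])
        (auto simp: greatest_def Lower_def opens_def)
  qed
qed

lemma (in monoidal_triangulated_category) thick_tensor_ideal_Obj: "thick_tensor_ideal C (Obj C)"
proof -
  have "Susp C X \<in> Obj C" if "X \<in> Obj C" for X
    using Susp_additive that by (auto simp: is_additive_functor_def is_functor_def)
  moreover have "Z \<in> Obj C" if "is_dist_triangle C X Y Z f g h" for X Y Z f g h
    using that Cod_closed by (auto simp: is_dist_triangle_def is_triangle_def Hom_def)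
  ultimately show ?thesis
    using Tens_closed
    by (auto simp: thick_tensor_ideal_def thick_subcategory_def is_zero_object_def is_biproduct_def)
qed

lemma (in monoidal_triangulated_category) semiprime_ideal_Obj: "semiprime_ideal C (Obj C)"
  using thick_tensor_ideal_Obj by (simp add: semiprime_ideal_def)

lemma thick_tensor_ideal_Inter:
  assumes "A \<noteq> {}" "\<And>J. J \<in> A \<Longrightarrow> thick_tensor_ideal C J"
  shows "thick_tensor_ideal C (\<Inter>A)"
  unfolding thick_tensor_ideal_def thick_subcategory_def
proof (intro conjI)
  have "J \<subseteq> Obj C" if "J \<in> A" for J
    using assms(2)[OF that] by (simp add: thick_tensor_ideal_def thick_subcategory_def)
  then show "\<Inter>A \<subseteq> Obj C"
    using assms(1) by blast
  have "Z \<in> J" if "J \<in> A" "is_zero_object C Z" for J Z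
    using assms(2)[OF that(1)] that(2) unfolding thick_tensor_ideal_def thick_subcategory_def by blast
  then show "\<forall>Z. is_zero_object C Z \<longrightarrow> Z \<in> \<Inter>A"
    by blast
  have "Y \<in> J" if "J \<in> A" "X \<in> J" "Y \<in> Obj C" "isomorphic C X Y" for J X Y
    using assms(2)[OF that(1)] that(2-4) unfolding thick_tensor_ideal_def thick_subcategory_def by blast
  then show "\<forall>X \<in> \<Inter>A. \<forall>Y \<in> Obj C. isomorphic C X Y \<longrightarrow> Y \<in> \<Inter>A"
    by (intro ballI impI InterI) (meson InterE)
  have "Susp C X \<in> J \<longleftrightarrow> X \<in> J" if "J \<in> A" "X \<in> Obj C" for J X
    using assms(2)[OF that(1)] that(2) unfolding thick_tensor_ideal_def thick_subcategory_def by blast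
  then show "\<forall>X \<in> Obj C. Susp C X \<in> \<Inter>A \<longleftrightarrow> X \<in> \<Inter>A"
    by blast
  have "Z \<in> J" if "J \<in> A" "is_dist_triangle C X Y Z f g h" "X \<in> J" "Y \<in> J" for J X Y Z f g h
    using assms(2)[OF that(1)] that(2-4) unfolding thick_tensor_ideal_def thick_subcategory_def by blast
  then show "\<forall>X Y Z f g h. is_dist_triangle C X Y Z f g h \<and> X \<in> \<Inter>A \<and> Y \<in> \<Inter>A \<longrightarrow> Z \<in> \<Inter>A"
    by (intro allI impI InterI) (meson InterE)
  have "X \<in> J" if "J \<in> A" "is_biproduct C X Y B" "B \<in> J" for J X Y B
    using assms(2)[OF that(1)] that(2,3) unfolding thick_tensor_ideal_def thick_subcategory_def by blast
  then show "\<forall>X Y B. is_biproduct C X Y B \<and> B \<in> \<Inter>A \<longrightarrow> X \<in> \<Inter>A"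
    by (intro allI impI InterI) (meson InterE)
  have "X \<odot>\<^bsub>C\<^esub> Y \<in> J \<and> Y \<odot>\<^bsub>C\<^esub> X \<in> J" if "J \<in> A" "X \<in> Obj C" "Y \<in> J" for J X Y
    using assms(2)[OF that(1)] that(2,3) unfolding thick_tensor_ideal_def by blast
  then show "\<forall>X \<in> Obj C. \<forall>Y \<in> \<Inter>A. X \<odot>\<^bsub>C\<^esub> Y \<in> \<Inter>A \<and> Y \<odot>\<^bsub>C\<^esub> X \<in> \<Inter>A"
    by blast
qed

lemma semiprime_ideal_Inter:
  assumes "A \<noteq> {}" "\<And>J. J \<in> A \<Longrightarrow> semiprime_ideal C J"
  shows "semiprime_ideal C (\<Inter>A)"
proof -
  have "thick_tensor_ideal C (\<Inter>A)"
    using assms by (intro thick_tensor_ideal_Inter) (auto simp: semiprime_ideal_def)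
  then show ?thesis
    using assms unfolding semiprime_ideal_def by blast
qed

lemma semiprime_ideal_subset: "semiprime_ideal C J \<Longrightarrow> J \<subseteq> Obj C"
  unfolding semiprime_ideal_def thick_tensor_ideal_def thick_subcategory_def by (elim conjE)

lemma (in monoidal_triangulated_category) complete_lattice_semiprime_lattice:
  "complete_lattice (semiprime_lattice C)"
proof -
  interpret L: partial_order "semiprime_lattice C"
    by standard (auto simp: semiprime_lattice_def)
  show ?thesis
  proof (rule L.complete_lattice_criterion1)
    show "\<exists>g. greatest (semiprime_lattice C) g (carrier (semiprime_lattice C))"
      by (rule exI[of _ "Obj C"])
        (simp add: greatest_def semiprime_lattice_def semiprime_ideal_Obj semiprime_ideal_subset)
    fix A assume A: "A \<subseteq> carrier (semiprime_lattice C)" "A \<noteq> {}"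
    then have semiprime: "semiprime_ideal C J" if "J \<in> A" for J
      using that by (auto simp: semiprime_lattice_def)
    then have "semiprime_ideal C (\<Inter>A)"
      using A(2) by (intro semiprime_ideal_Inter)
    then have "greatest (semiprime_lattice C) (\<Inter>A) (Lower (semiprime_lattice C) A)"
      unfolding greatest_def Lower_def semiprime_lattice_def
      using semiprime by (simp add: Inter_lower Inter_greatest)
    then show "\<exists>i. greatest (semiprime_lattice C) i (Lower (semiprime_lattice C) A)"
      by blast
  qed
qed

lemma sup_two: "\<Squnion>\<^bsub>two\<^esub>A \<longleftrightarrow> True \<in> A"
proof -
  interpret two: complete_lattice two by (rule complete_lattice_two)
  have "least two (\<Squnion>\<^bsub>two\<^esub>A) (Upper two A)"
    by (rule two.weak.sup_lub) (simp add: two_def)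
  from two.least_unique[OF this least_two] show ?thesis
    by simp
qed

lemma inf_two: "\<Sqinter>\<^bsub>two\<^esub>A \<longleftrightarrow> False \<notin> A"
proof -
  interpret two: complete_lattice two by (rule complete_lattice_two)
  have "greatest two (\<Sqinter>\<^bsub>two\<^esub>A) (Lower two A)"
    by (rule two.weak.inf_glb) (simp add: two_def)
  from two.greatest_unique[OF this greatest_two] show ?thesis
    by simp
qed

lemma CLat_inf:
  "\<lbrakk>p \<in> CLat L M; A \<subseteq> carrier L; finite A\<rbrakk> \<Longrightarrow> p (\<Sqinter>\<^bsub>L\<^esub>A) = \<Sqinter>\<^bsub>M\<^esub>(p ` A)"
  unfolding CLat_def by simp

lemma CLat_sup: "\<lbrakk>p \<in> CLat L M; A \<subseteq> carrier L\<rbrakk> \<Longrightarrow> p (\<Squnion>\<^bsub>L\<^esub>A) = \<Squnion>\<^bsub>M\<^esub>(p ` A)"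
  unfolding CLat_def sup_pres_def by simp

lemma openin_point_space:
  fixes L (structure)
  assumes "complete_lattice L"
  shows "openin (point_space L) U \<longleftrightarrow> (\<exists>l \<in> carrier L. U = {p \<in> CLat L two. p l = True})"
proof -
  interpret complete_lattice L by fact
  let ?U = "\<lambda>l. {p \<in> CLat L two. p l = True}"
  have "istopology (\<lambda>U. \<exists>l \<in> carrier L. U = ?U l)"
    unfolding istopology_def
  proof (intro conjI allI impI)
    fix S T
    assume "\<exists>l \<in> carrier L. S = ?U l" and "\<exists>m \<in> carrier L. T = ?U m"
    then obtain l m where lm: "l \<in> carrier L" "m \<in> carrier L" "S = ?U l" "T = ?U m"
      by blast
    have "p (l \<sqinter> m) \<longleftrightarrow> p l \<and> p m" if "p \<in> CLat L two" for p
    proof -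
      have "p (\<Sqinter>{l, m}) = \<Sqinter>\<^bsub>two\<^esub>(p ` {l, m})"
        using CLat_inf[OF that, of "{l, m}"] lm(1,2) by simp
      then show ?thesis
        by (auto simp: meet_def inf_two)
    qed
    then have "S \<inter> T = ?U (l \<sqinter> m)"
      using lm by auto
    then show "\<exists>l \<in> carrier L. S \<inter> T = ?U l"
      using lm by (intro bexI[of _ "l \<sqinter> m"]) auto
  next
    fix \<K> assume K: "\<forall>K \<in> \<K>. \<exists>l \<in> carrier L. K = ?U l"
    define A where "A = {l \<in> carrier L. ?U l \<in> \<K>}"
    have A: "A \<subseteq> carrier L" by (auto simp: A_def)
    have "p (\<Squnion>A) \<longleftrightarrow> (\<exists>l \<in> A. p l)" if "p \<in> CLat L two" for p
    proof -
      have "p (\<Squnion>A) = \<Squnion>\<^bsub>two\<^esub>(p ` A)"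
        by (rule CLat_sup[OF that A])
      then show ?thesis
        by (auto simp: sup_two)
    qed
    moreover have "\<Union>\<K> = (\<Union>l \<in> A. ?U l)"
      using K unfolding A_def by auto
    ultimately have "\<Union>\<K> = ?U (\<Squnion>A)"
      by auto
    then show "\<exists>l \<in> carrier L. \<Union>\<K> = ?U l"
      using A by (intro bexI[of _ "\<Squnion>A"]) auto
  qed
  then show ?thesis
    unfolding point_space_def by simp
qed

lemma topspace_dual_space: "topspace (dual_space X) = topspace X"
proof -
  have "topspace X \<in> {topspace X - K | K. openin X K \<and> compactin X K}"
    by (rule CollectI, rule exI[of _ "{}"]) simp
  then show ?thesis
    unfolding dual_space_def topology_generated_by_topspace by (intro equalityI Union_upper) auto
qed

end

theory Submission
  imports Defs
begin

text \<open>
  Write \<open>L\<close> for the lattice of semiprime ideals, which here is the lattice of all thick tensor ideals,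
  with intersection as meet.

  Prime ideals are the meet-prime elements of \<open>L\<close>, because \<open>I \<otimes> J \<subseteq> P\<close> and \<open>I \<inter> J \<subseteq> P\<close> are equivalent.
  The product of two ideals lies in their intersection; conversely, if \<open>r\<close> lies in \<open>I \<inter> J\<close>, then every
  \<open>r \<otimes> s \<otimes> r\<close> lies in \<open>I \<otimes> J\<close>, and \<open>P\<close> is semiprime. This is \<open>prime_ideal_iff_meet_prime\<close>.
  Meet-prime elements correspond to points by \<open>p \<mapsto> \<Squnion>{a. p a = 0}\<close>, for any complete lattice.

  For the topologies, let \<open>D(s)\<close> be the set of primes that do not contain the object \<open>s\<close>. The closed
  sets of the noncommutative Balmer spectrum are the intersections of sets \<open>D(s)\<close>. On the other side,
  the open sets of the point space are the unions of sets \<open>D(s)\<close>. So the two topologies match once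
  each \<open>D(s)\<close> is quasi-compact: then the quasi-compact opens are the finite unions of sets
  \<open>D(s)\<close>, and these generate the same closed sets as the sets \<open>D(s)\<close> alone.

  Quasi-compactness of \<open>D(s)\<close> has two ingredients. An ideal that does not contain \<open>s\<close> lies in a prime that
  does not contain \<open>s\<close> (\<open>prime_ideal_separation\<close>), so a family of opens covers \<open>D(s)\<close> exactly when \<open>s\<close> lies in
  the ideal generated by the corresponding objects. And the ideal generated by a set is the directed
  union of the ideals generated by its finite subsets (\<open>generated_ideal_finitary\<close>).

  That the prescribed closed sets form a topology on the spectrum at all rests on the equivalence of
  \<open>B \<in> P\<close> with \<open>X \<in> P \<and> Y \<in> P\<close> for a biproduct \<open>B\<close> of \<open>X\<close> and \<open>Y\<close> (\<open>thick_subcategory_biproduct\<close>).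

  Finally, the point space of any complete lattice is sober, so it is homeomorphic to the spectrum of
  its frame of opens, and the passage to the dual topology respects homeomorphisms.
\<close>

section \<open>Points of a complete lattice\<close>

text \<open>In \<open>two\<close> a join is an existential quantifier and a meet a universal one, so that points become
  predicates on the lattice.\<close>

lemma CLat_two_iff:
  fixes L (structure)
  assumes "complete_lattice L"
  shows "p \<in> CLat L two \<longleftrightarrow> p \<in> extensional (carrier L) \<and>
     (\<forall>A \<subseteq> carrier L. p (\<Squnion>A) \<longleftrightarrow> (\<exists>a \<in> A. p a)) \<and>
     (\<forall>A \<subseteq> carrier L. finite A \<longrightarrow> (p (\<Sqinter>A) \<longleftrightarrow> (\<forall>a \<in> A. p a)))"
proof -
  interpret complete_lattice L by fact
  interpret two: complete_lattice two by (rule complete_lattice_two)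
  have "isotone L two p" if sup: "\<forall>A \<subseteq> carrier L. p (\<Squnion>A) \<longleftrightarrow> (\<exists>a \<in> A. p a)"
  proof (rule isotoneI)
    fix x y assume xy: "x \<in> carrier L" "y \<in> carrier L" "x \<sqsubseteq> y"
    then have "\<Squnion>{x, y} = y"
      using weak_le_iff_meet[of x y] by (simp add: join_def eq_is_equal)
    then have "p x \<Longrightarrow> p y"
      using sup[rule_format, of "{x, y}"] xy by auto
    then show "p x \<sqsubseteq>\<^bsub>two\<^esub> p y" by (simp add: two_def)
  qed (rule weak_partial_order_axioms two.weak_partial_order_axioms)+
  then show ?thesis
    unfolding CLat_def sup_pres_def
    using assms complete_lattice_two
    by (auto simp: sup_two inf_two PiE_def two_def[THEN arg_cong[where f = carrier]])
qed

text \<open>The empty meet is the top element, which is not below a meet-prime element; this case accounts for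
  the condition \<open>x \<noteq> \<top>\<close>.\<close>

lemma meet_prime_finite_inf:
  fixes L (structure)
  assumes "complete_lattice L" and x: "meet_prime L x" and A: "finite A" "A \<subseteq> carrier L" and le: "\<Sqinter>A \<sqsubseteq> x"
  shows "\<exists>a \<in> A. a \<sqsubseteq> x"
proof -
  interpret complete_lattice L by fact
  show ?thesis
    using A le
  proof (induction A)
    case empty
    have "\<Sqinter>{} = \<top>" using weak_inf_empty by (simp add: eq_is_equal)
    then have "x = \<top>"
      using empty x top_higher le_antisym top_closed unfolding meet_prime_def by metis
    then show ?case using x by (simp add: meet_prime_def)
  next
    case (insert a A)
    then have "a \<sqinter> \<Sqinter>A \<sqsubseteq> x" using weak_inf_insert[of a A] by (simp add: eq_is_equal)
    then have "a \<sqsubseteq> x \<or> \<Sqinter>A \<sqsubseteq> x"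
      using x insert.prems(1) inf_closed[of A] unfolding meet_prime_def by simp
    then show ?case using insert by auto
  qed
qed

lemma (in complete_lattice) sup_le_iff: "\<lbrakk>A \<subseteq> carrier L; x \<in> carrier L\<rbrakk> \<Longrightarrow> \<Squnion>A \<sqsubseteq> x \<longleftrightarrow> (\<forall>a \<in> A. a \<sqsubseteq> x)"
  using sup_least[of A x] sup_upper[of A] le_trans[of _ "\<Squnion>A" x] sup_closed[of A] by blast

lemma point_of_CLat:
  fixes L (structure)
  assumes L: "complete_lattice L" and x: "meet_prime L x"
  shows "point_of L x \<in> CLat L two"
  unfolding CLat_two_iff[OF L]
proof (intro conjI allI impI)
  interpret complete_lattice L by fact
  have xL: "x \<in> carrier L" using x by (simp add: meet_prime_def)
  show "point_of L x \<in> extensional (carrier L)" by (simp add: point_of_def)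
  fix A assume A: "A \<subseteq> carrier L"
  show "point_of L x (\<Squnion>A) \<longleftrightarrow> (\<exists>a \<in> A. point_of L x a)"
    using A xL by (auto simp: point_of_def sup_le_iff)
  assume "finite A"
  have "\<Sqinter>A \<sqsubseteq> x \<longleftrightarrow> (\<exists>a \<in> A. a \<sqsubseteq> x)"
  proof
    assume "\<exists>a \<in> A. a \<sqsubseteq> x"
    then show "\<Sqinter>A \<sqsubseteq> x"
      using le_trans[OF inf_lower[OF A]] inf_closed[OF A] xL A by blast
  qed (rule meet_prime_finite_inf[OF L x \<open>finite A\<close> A])
  then show "point_of L x (\<Sqinter>A) \<longleftrightarrow> (\<forall>a \<in> A. point_of L x a)"
    using A by (auto simp: point_of_def)
qed

text \<open>The elements sent to 0 by a point are closed under arbitrary joins, so they have a greatest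
  element, and the point is determined by it.\<close>

lemma CLat_point_of:
  fixes L (structure)
  assumes L: "complete_lattice L" and p: "p \<in> CLat L two"
  obtains x where "meet_prime L x" "p = point_of L x"
proof
  interpret complete_lattice L by fact
  let ?N = "{a \<in> carrier L. \<not> p a}"
  let ?x = "\<Squnion>?N"
  have sup: "p (\<Squnion>A) \<longleftrightarrow> (\<exists>a \<in> A. p a)" if "A \<subseteq> carrier L" for A
    using p that unfolding CLat_two_iff[OF L] by blast
  have inf: "p (\<Sqinter>A) \<longleftrightarrow> (\<forall>a \<in> A. p a)" if "A \<subseteq> carrier L" "finite A" for A
    using p that unfolding CLat_two_iff[OF L] by blast
  have ext: "p \<in> extensional (carrier L)"
    using p unfolding CLat_two_iff[OF L] by blast
  have N: "?N \<subseteq> carrier L" by auto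
  have xL: "?x \<in> carrier L" by (rule sup_closed[OF N])
  have px: "\<not> p ?x" using sup[OF N] by auto
  have iff: "p a \<longleftrightarrow> \<not> a \<sqsubseteq> ?x" if a: "a \<in> carrier L" for a
  proof
    assume "p a"
    show "\<not> a \<sqsubseteq> ?x"
    proof
      assume "a \<sqsubseteq> ?x"
      then have "\<Squnion>{a, ?x} = ?x" using a xL weak_le_iff_meet[of a ?x] by (simp add: join_def eq_is_equal)
      then show False using sup[of "{a, ?x}"] a xL \<open>p a\<close> px by auto
    qed
  qed (use sup_upper[OF N] a in blast)
  show "meet_prime L ?x"
    unfolding meet_prime_def
  proof (intro conjI ballI impI)
    have "p \<top>" using inf[of "{}"] weak_inf_empty by (simp add: eq_is_equal)
    then show "?x \<noteq> \<top>" using px by auto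
    fix l m assume lm: "l \<in> carrier L" "m \<in> carrier L" "l \<sqinter> m \<sqsubseteq> ?x"
    then have "\<not> p (l \<sqinter> m)" using iff[of "l \<sqinter> m"] by simp
    then show "l \<sqsubseteq> ?x \<or> m \<sqsubseteq> ?x"
      using inf[of "{l, m}"] lm iff by (auto simp: meet_def)
  qed (rule xL)
  show "p = point_of L ?x"
  proof
    fix a show "p a = point_of L ?x a"
      using iff[of a] ext by (cases "a \<in> carrier L") (auto simp: point_of_def extensional_def)
  qed
qed

lemma bij_betw_point_of:
  fixes L (structure)
  assumes L: "complete_lattice L"
  shows "bij_betw (point_of L) {x. meet_prime L x} (CLat L two)"
  unfolding bij_betw_def
proof
  interpret complete_lattice L by fact
  show "inj_on (point_of L) {x. meet_prime L x}"
  proof (rule inj_onI)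
    fix x y assume xy: "x \<in> {x. meet_prime L x}" "y \<in> {x. meet_prime L x}" "point_of L x = point_of L y"
    then have L: "x \<in> carrier L" "y \<in> carrier L" by (auto simp: meet_prime_def)
    have "point_of L x x = point_of L y x" "point_of L x y = point_of L y y" using xy(3) by auto
    then show "x = y" using L by (auto simp: point_of_def intro: le_antisym)
  qed
  show "point_of L ` {x. meet_prime L x} = CLat L two"
    using point_of_CLat[OF L] CLat_point_of[OF L] by blast
qed

lemma topspace_point_space:
  fixes L (structure)
  assumes "complete_lattice L"
  shows "topspace (point_space L) = CLat L two"
proof
  interpret complete_lattice L by fact
  show "topspace (point_space L) \<subseteq> CLat L two"
    using openin_topspace[of "point_space L"] unfolding openin_point_space[OF assms] by auto
  have "p \<top>" if "p \<in> CLat L two" for p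
    using that weak_inf_empty unfolding CLat_two_iff[OF assms] eq_is_equal by force
  then have "openin (point_space L) (CLat L two)"
    unfolding openin_point_space[OF assms] by (intro bexI[of _ \<top>]) auto
  then show "CLat L two \<subseteq> topspace (point_space L)" by (rule openin_subset)
qed

section \<open>Sobriety and the dual topology\<close>

lemma sup_opens:
  assumes "A \<subseteq> carrier (opens X)"
  shows "\<Squnion>\<^bsub>opens X\<^esub>A = \<Union>A"
proof -
  interpret complete_lattice "opens X" by (rule complete_lattice_opens)
  have "\<Squnion>\<^bsub>opens X\<^esub>A \<subseteq> \<Union>A"
    using sup_least[OF assms, of "\<Union>A"] assms by (auto simp: opens_def)
  moreover have "\<Union>A \<subseteq> \<Squnion>\<^bsub>opens X\<^esub>A"
    using sup_upper[OF assms] by (auto simp: opens_def)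
  ultimately show ?thesis by blast
qed

text \<open>The factor \<open>topspace X\<close> takes care of the empty meet.\<close>

lemma finite_inf_opens:
  assumes A: "A \<subseteq> carrier (opens X)" "finite A"
  shows "\<Sqinter>\<^bsub>opens X\<^esub>A = topspace X \<inter> \<Inter>A"
proof -
  interpret complete_lattice "opens X" by (rule complete_lattice_opens)
  have "openin X (topspace X \<inter> \<Inter>A)"
    using A openin_Int_Inter[of A X "topspace X"] by (auto simp: opens_def)
  then have "topspace X \<inter> \<Inter>A \<subseteq> \<Sqinter>\<^bsub>opens X\<^esub>A"
    using inf_greatest[OF A(1), of "topspace X \<inter> \<Inter>A"] by (auto simp: opens_def)
  moreover have "\<Sqinter>\<^bsub>opens X\<^esub>A \<subseteq> \<Inter>A"
    using inf_lower[OF A(1)] by (auto simp: opens_def)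
  moreover have "\<Sqinter>\<^bsub>opens X\<^esub>A \<subseteq> topspace X"
    using inf_closed[OF A(1)] by (auto simp: opens_def dest: openin_subset)
  ultimately show ?thesis by blast
qed

lemma point_eval_CLat:
  assumes "x \<in> topspace X"
  shows "point_eval X x \<in> CLat (opens X) two"
  unfolding CLat_two_iff[OF complete_lattice_opens]
proof (intro conjI allI impI)
  interpret complete_lattice "opens X" by (rule complete_lattice_opens)
  show "point_eval X x \<in> extensional (carrier (opens X))" by (simp add: point_eval_def opens_def)
  have *: "point_eval X x U \<longleftrightarrow> x \<in> U" if "U \<in> carrier (opens X)" for U
    using that by (simp add: point_eval_def opens_def)
  fix A assume A: "A \<subseteq> carrier (opens X)"
  have eval: "point_eval X x U \<longleftrightarrow> x \<in> U" if "U \<in> A" for U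
    using * A that by blast
  have "point_eval X x (\<Squnion>\<^bsub>opens X\<^esub>A) \<longleftrightarrow> x \<in> \<Union>A"
    using *[OF sup_closed[OF A]] by (simp add: sup_opens[OF A])
  then show "point_eval X x (\<Squnion>\<^bsub>opens X\<^esub>A) \<longleftrightarrow> (\<exists>U \<in> A. point_eval X x U)"
    using eval by blast
  assume fin: "finite A"
  have "point_eval X x (\<Sqinter>\<^bsub>opens X\<^esub>A) \<longleftrightarrow> x \<in> topspace X \<inter> \<Inter>A"
    using *[OF inf_closed[OF A]] by (simp add: finite_inf_opens[OF A fin])
  then show "point_eval X x (\<Sqinter>\<^bsub>opens X\<^esub>A) \<longleftrightarrow> (\<forall>U \<in> A. point_eval X x U)"
    using eval assms by blast
qed

text \<open>Sobriety: the opens of the point space are the sets \<open>U l\<close>, and \<open>U\<close> preserves joins and finite meets,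
  so that a point \<open>\<phi>\<close> of the frame of opens restricts along \<open>U\<close> to a point \<open>p\<close> of \<open>L\<close>. Since \<open>p \<in> U l\<close> is
  \<open>\<phi> (U l)\<close>, evaluation at \<open>p\<close> is \<open>\<phi>\<close>.\<close>

lemma CLat_opens_point_space:
  fixes L (structure)
  assumes L: "complete_lattice L" and \<phi>: "\<phi> \<in> CLat (opens (point_space L)) two"
  shows "\<phi> \<in> point_eval (point_space L) ` CLat L two"
proof -
  interpret complete_lattice L by fact
  let ?X = "point_space L"
  define U where "U l = {p \<in> CLat L two. p l}" for l
  have U: "U l \<in> carrier (opens ?X)" if "l \<in> carrier L" for l
    using that openin_point_space[OF L] by (auto simp: opens_def U_def)
  have top: "topspace ?X = CLat L two" by (rule topspace_point_space[OF L])
  have sup: "\<phi> (\<Squnion>\<^bsub>opens ?X\<^esub>A) \<longleftrightarrow> (\<exists>a \<in> A. \<phi> a)" if "A \<subseteq> carrier (opens ?X)" for A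
    using \<phi> that unfolding CLat_two_iff[OF complete_lattice_opens] by blast
  have inf: "\<phi> (\<Sqinter>\<^bsub>opens ?X\<^esub>A) \<longleftrightarrow> (\<forall>a \<in> A. \<phi> a)" if "A \<subseteq> carrier (opens ?X)" "finite A" for A
    using \<phi> that unfolding CLat_two_iff[OF complete_lattice_opens] by blast
  have ext: "\<phi> \<in> extensional (carrier (opens ?X))"
    using \<phi> unfolding CLat_two_iff[OF complete_lattice_opens] by blast
  define p where "p = restrict (\<lambda>l. \<phi> (U l)) (carrier L)"
  have p: "p l \<longleftrightarrow> \<phi> (U l)" if "l \<in> carrier L" for l using that by (simp add: p_def)
  have pC: "p \<in> CLat L two"
    unfolding CLat_two_iff[OF L]
  proof (intro conjI allI impI)
    show "p \<in> extensional (carrier L)" by (simp add: p_def)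
    fix A assume A: "A \<subseteq> carrier L"
    then have UA: "U ` A \<subseteq> carrier (opens ?X)" using U by blast
    have pA: "p a \<longleftrightarrow> \<phi> (U a)" if "a \<in> A" for a using p A that by blast
    have "U (\<Squnion>A) = \<Union>(U ` A)"
      using A unfolding U_def CLat_two_iff[OF L] by auto
    then have "U (\<Squnion>A) = \<Squnion>\<^bsub>opens ?X\<^esub>(U ` A)"
      using sup_opens[OF UA] by simp
    then show "p (\<Squnion>A) \<longleftrightarrow> (\<exists>a \<in> A. p a)"
      using p[OF sup_closed[OF A]] pA sup[OF UA] by simp
    assume fin: "finite A"
    have "q (\<Sqinter>A) \<longleftrightarrow> (\<forall>a \<in> A. q a)" if "q \<in> CLat L two" for q
      using that A fin unfolding CLat_two_iff[OF L] by blast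
    then have "U (\<Sqinter>A) = CLat L two \<inter> \<Inter>(U ` A)"
      unfolding U_def by blast
    then have "U (\<Sqinter>A) = \<Sqinter>\<^bsub>opens ?X\<^esub>(U ` A)"
      using finite_inf_opens[OF UA] fin top by simp
    then show "p (\<Sqinter>A) \<longleftrightarrow> (\<forall>a \<in> A. p a)"
      using p[OF inf_closed[OF A]] pA inf[OF UA] fin by simp
  qed
  have "\<phi> = point_eval ?X p"
  proof
    fix V
    show "\<phi> V = point_eval ?X p V"
    proof (cases "openin ?X V")
      case True
      then obtain l where l: "l \<in> carrier L" "V = U l"
        unfolding openin_point_space[OF L] U_def by auto
      then show ?thesis using True pC p[OF l(1)] by (simp add: point_eval_def U_def)
    next
      case False
      then show ?thesis using ext by (simp add: point_eval_def opens_def extensional_def)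
    qed
  qed
  then show ?thesis using pC by blast
qed

lemma homeomorphic_map_point_eval:
  fixes L (structure)
  assumes L: "complete_lattice L"
  shows "homeomorphic_map (point_space L) (point_space (opens (point_space L))) (point_eval (point_space L))"
proof (rule bijective_open_imp_homeomorphic_map)
  let ?X = "point_space L" let ?Y = "point_space (opens ?X)" let ?e = "point_eval ?X"
  have top: "topspace ?X = CLat L two" "topspace ?Y = CLat (opens ?X) two"
    by (rule topspace_point_space; rule L complete_lattice_opens)+
  have e: "?e p V \<longleftrightarrow> p \<in> V" if "openin ?X V" for p V
    using that by (simp add: point_eval_def)
  have e_closed: "?e p \<in> CLat (opens ?X) two" if "p \<in> CLat L two" for p
    using point_eval_CLat[of p ?X] that top by simp
  have oY: "openin ?Y W \<longleftrightarrow> (\<exists>V. openin ?X V \<and> W = {\<phi> \<in> CLat (opens ?X) two. \<phi> V})" for W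
    using openin_point_space[OF complete_lattice_opens[of ?X], of W] by (auto simp: opens_def)
  have preimage: "?e p \<in> {\<phi> \<in> CLat (opens ?X) two. \<phi> V} \<longleftrightarrow> p \<in> V"
    if "openin ?X V" "p \<in> CLat L two" for V p
    using e[OF that(1)] e_closed[OF that(2)] by simp
  show img: "?e ` topspace ?X = topspace ?Y"
    using e_closed CLat_opens_point_space[OF L] top by blast
  show "continuous_map ?X ?Y ?e"
    unfolding continuous_map
  proof (intro conjI allI impI)
    fix W assume "openin ?Y W"
    then obtain V where V: "openin ?X V" "W = {\<phi> \<in> CLat (opens ?X) two. \<phi> V}"
      unfolding oY by blast
    have "{p \<in> topspace ?X. ?e p \<in> W} = V"
      unfolding V(2) using preimage[OF V(1)] openin_subset[OF V(1)] unfolding top by blast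
    then show "openin ?X {p \<in> topspace ?X. ?e p \<in> W}" using V(1) by simp
  qed (use img in blast)
  show "open_map ?X ?Y ?e"
    unfolding open_map_def
  proof (intro allI impI)
    fix V assume V: "openin ?X V"
    have VC: "V \<subseteq> CLat L two" using openin_subset[OF V] top by simp
    have "?e ` V = {\<phi> \<in> CLat (opens ?X) two. \<phi> V}"
    proof (intro equalityI subsetI)
      fix \<phi> assume \<phi>: "\<phi> \<in> {\<phi> \<in> CLat (opens ?X) two. \<phi> V}"
      then obtain p where p: "p \<in> CLat L two" "\<phi> = ?e p" using CLat_opens_point_space[OF L] by blast
      with \<phi> preimage[OF V p(1)] show "\<phi> \<in> ?e ` V" by blast
    qed (use preimage[OF V] VC in blast)
    then show "openin ?Y (?e ` V)" unfolding oY using V by blast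
  qed
  show "inj_on ?e (topspace ?X)"
  proof (rule inj_onI)
    fix p q assume pq: "p \<in> topspace ?X" "q \<in> topspace ?X" "?e p = ?e q"
    show "p = q"
    proof
      fix l
      show "p l = q l"
      proof (cases "l \<in> carrier L")
        case True
        let ?V = "{p \<in> CLat L two. p l}"
        have V: "openin ?X ?V" unfolding openin_point_space[OF L] using True by auto
        have "p \<in> ?V \<longleftrightarrow> q \<in> ?V" using e[OF V, of p] e[OF V, of q] unfolding pq(3) by blast
        then show ?thesis using pq(1,2) unfolding top by blast
      next
        case False
        have "p \<in> extensional (carrier L)" "q \<in> extensional (carrier L)"
          using pq(1,2) unfolding top CLat_two_iff[OF L] by blast+
        then show ?thesis using extensional_arb[of p _ l] extensional_arb[of q _ l] False by blast
      qed
    qed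
  qed
qed

lemma openin_dual_space: "\<lbrakk>openin X K; compactin X K\<rbrakk> \<Longrightarrow> openin (dual_space X) (topspace X - K)"
  unfolding dual_space_def by (rule topology_generated_by_Basis) blast

lemma continuous_map_dual_space:
  assumes f: "f ` topspace X \<subseteq> topspace Y"
    and "\<And>K. \<lbrakk>openin Y K; compactin Y K\<rbrakk> \<Longrightarrow> openin X {x \<in> topspace X. f x \<notin> K}"
  shows "continuous_map X (dual_space Y) f"
  unfolding dual_space_def
proof (rule continuous_on_generated_topo)
  fix U assume "U \<in> {topspace Y - K | K. openin Y K \<and> compactin Y K}"
  then obtain K where K: "U = topspace Y - K" "openin Y K" "compactin Y K" by blast
  then have "f -` U \<inter> topspace X = {x \<in> topspace X. f x \<notin> K}" using f by auto
  then show "openin X (f -` U \<inter> topspace X)" using assms(2) K by simp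
next
  show "f ` topspace X \<subseteq> \<Union>{topspace Y - K | K. openin Y K \<and> compactin Y K}"
    using f topspace_dual_space[of Y] unfolding dual_space_def by simp
qed

text \<open>The preimage of a quasi-compact open set is its image under the inverse homeomorphism.\<close>

lemma homeomorphic_maps_dual_space_continuous:
  assumes hom: "homeomorphic_maps A B h k"
  shows "continuous_map (dual_space A) (dual_space B) h"
proof (rule continuous_map_dual_space)
  have h: "homeomorphic_map A B h" and k: "homeomorphic_map B A k"
    using hom homeomorphic_maps_map by blast+
  show "h ` topspace (dual_space A) \<subseteq> topspace B"
    using homeomorphic_imp_surjective_map[OF h] by (simp add: topspace_dual_space)
  fix K assume K: "openin B K" "compactin B K"
  then have KB: "K \<subseteq> topspace B" by (simp add: openin_subset)
  have "{x \<in> topspace A. h x \<notin> K} = topspace A - k ` K"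
    using hom KB homeomorphic_imp_surjective_map[OF h] unfolding homeomorphic_maps_def by force
  moreover have "openin A (k ` K)" "compactin A (k ` K)"
    using homeomorphic_map_openness[OF k KB] homeomorphic_map_compactness[OF k KB] K by auto
  ultimately show "openin (dual_space A) {x \<in> topspace (dual_space A). h x \<notin> K}"
    using openin_dual_space[of A "k ` K"] by (simp add: topspace_dual_space)
qed

lemma homeomorphic_map_dual_space:
  assumes "homeomorphic_map X Y f"
  shows "homeomorphic_map (dual_space X) (dual_space Y) f"
proof -
  obtain g where g: "homeomorphic_maps X Y f g" using assms homeomorphic_map_maps by blast
  then have g': "homeomorphic_maps Y X g f" using homeomorphic_maps_sym by blast
  then have "homeomorphic_maps (dual_space X) (dual_space Y) f g"
    using g homeomorphic_maps_dual_space_continuous[OF g] homeomorphic_maps_dual_space_continuous[OF g']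
    unfolding homeomorphic_maps_def topspace_dual_space by blast
  then show ?thesis using homeomorphic_map_maps by blast
qed

section \<open>Additive functors and biproducts\<close>

lemma Hom_Obj:
  assumes "category C" "f \<in> Hom C X Y"
  shows "X \<in> Obj C" "Y \<in> Obj C"
  using assms category.Dom_closed[of C f] category.Cod_closed[of C f] by (auto simp: Hom_def)

lemma isomorphic_sym: "isomorphic C X Y \<Longrightarrow> isomorphic C Y X"
  unfolding isomorphic_def is_iso_def by blast

lemma functor_Comp:
  assumes "category C" "is_functor C D FO FM" "f \<in> Hom C X Y" "g \<in> Hom C Y Z"
  shows "FM (g \<cdot>\<^bsub>C\<^esub> f) = FM g \<cdot>\<^bsub>D\<^esub> FM f"
  using assms(2-) Hom_Obj[OF assms(1,3)] Hom_Obj[OF assms(1,4)] unfolding is_functor_def by blast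

lemma functor_Hom:
  assumes "category C" "is_functor C D FO FM" "f \<in> Hom C X Y"
  shows "FM f \<in> Hom D (FO X) (FO Y)"
  using assms(2,3) Hom_Obj[OF assms(1,3)] unfolding is_functor_def by blast

lemma functor_isomorphic:
  assumes "category C" "is_functor C D FO FM" "isomorphic C X Y"
  shows "isomorphic D (FO X) (FO Y)"
proof -
  obtain f g where fg: "f \<in> Hom C X Y" "g \<in> Hom C Y X"
    "g \<cdot>\<^bsub>C\<^esub> f = Ident C X" "f \<cdot>\<^bsub>C\<^esub> g = Ident C Y"
    using assms(3) unfolding isomorphic_def is_iso_def by blast
  have "FM g \<cdot>\<^bsub>D\<^esub> FM f = Ident D (FO X)" "FM f \<cdot>\<^bsub>D\<^esub> FM g = Ident D (FO Y)"
    using functor_Comp[OF assms(1,2) fg(1,2)] functor_Comp[OF assms(1,2) fg(2,1)] fg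
      Hom_Obj[OF assms(1) fg(1)] assms(2) unfolding is_functor_def by metis+
  then show ?thesis
    using functor_Hom[OF assms(1,2)] fg unfolding isomorphic_def is_iso_def by blast
qed

context additive_category
begin

lemma ZeroMor_Hom: "\<lbrakk>X \<in> Obj C; Y \<in> Obj C\<rbrakk> \<Longrightarrow> ZeroMor C X Y \<in> Hom C X Y"
  using monoid.one_closed[OF group.is_monoid[OF comm_group.axioms(2)[OF hom_comm_group]], of X Y]
  by (simp add: hom_group_def)

lemma hom_group_group: "\<lbrakk>X \<in> Obj C; Y \<in> Obj C\<rbrakk> \<Longrightarrow> group (hom_group C X Y)"
  using hom_comm_group comm_group.axioms(2) by blast

text \<open>This is how a map that respects sums is seen to respect zero morphisms: composition on either
  side, and the action of an additive functor.\<close>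

lemma idem_ZeroMor:
  assumes "f \<in> Hom C X Y" "Plus C f f = f"
  shows "f = ZeroMor C X Y"
  using group.l_cancel_one[OF hom_group_group[OF Hom_Obj[OF category_axioms assms(1)]], of f f] assms
  by (simp add: hom_group_def)

lemma Plus_ZeroMor:
  assumes "X \<in> Obj C" "Y \<in> Obj C"
  shows "Plus C (ZeroMor C X Y) (ZeroMor C X Y) = ZeroMor C X Y"
  using monoid.l_one[OF group.is_monoid[OF hom_group_group[OF assms]], of "ZeroMor C X Y"]
    ZeroMor_Hom[OF assms] by (simp add: hom_group_def)

lemma ZeroMor_Comp:
  assumes f: "f \<in> Hom C X Y" and Z: "Z \<in> Obj C"
  shows "ZeroMor C Y Z \<cdot> f = ZeroMor C X Z"
proof (rule idem_ZeroMor)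
  have Y: "Y \<in> Obj C" using Hom_Obj[OF category_axioms f] by simp
  note z = ZeroMor_Hom[OF Y Z]
  show "ZeroMor C Y Z \<cdot> f \<in> Hom C X Z" by (rule Comp_closed[OF f z])
  show "Plus C (ZeroMor C Y Z \<cdot> f) (ZeroMor C Y Z \<cdot> f) = ZeroMor C Y Z \<cdot> f"
    using Comp_Plus_left[OF f z z] Plus_ZeroMor[OF Y Z] by simp
qed

lemma Comp_ZeroMor:
  assumes g: "g \<in> Hom C Y Z" and X: "X \<in> Obj C"
  shows "g \<cdot> ZeroMor C X Y = ZeroMor C X Z"
proof (rule idem_ZeroMor)
  have Y: "Y \<in> Obj C" using Hom_Obj[OF category_axioms g] by simp
  note z = ZeroMor_Hom[OF X Y]
  show "g \<cdot> ZeroMor C X Y \<in> Hom C X Z" by (rule Comp_closed[OF z g])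
  show "Plus C (g \<cdot> ZeroMor C X Y) (g \<cdot> ZeroMor C X Y) = g \<cdot> ZeroMor C X Y"
    using Comp_Plus_right[OF z z g] Plus_ZeroMor[OF X Y] by simp
qed

text \<open>An equation between morphisms, and therefore visibly preserved by additive functors.\<close>

lemma is_zero_object_iff:
  "is_zero_object C Z \<longleftrightarrow> Z \<in> Obj C \<and> Ident C Z = ZeroMor C Z Z"
proof
  assume "is_zero_object C Z"
  then show "Z \<in> Obj C \<and> Ident C Z = ZeroMor C Z Z"
    using Ident_closed[of Z] ZeroMor_Hom[of Z Z] unfolding is_zero_object_def by blast
next
  assume Z: "Z \<in> Obj C \<and> Ident C Z = ZeroMor C Z Z"
  have "f = ZeroMor C X Z" if "f \<in> Hom C X Z" for f X
    using Comp_Ident_left[OF that] ZeroMor_Comp[OF that] Z by simp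
  moreover have "f = ZeroMor C Z X" if "f \<in> Hom C Z X" for f X
    using Comp_Ident_right[OF that] Comp_ZeroMor[OF that] Z by simp
  ultimately show "is_zero_object C Z"
    using Z ZeroMor_Hom unfolding is_zero_object_def by metis
qed

lemma Neg_Hom:
  assumes "f \<in> Hom C X Y"
  shows "Neg C f \<in> Hom C X Y"
  using group.inv_closed[OF hom_group_group[OF Hom_Obj[OF category_axioms assms]], of f] assms
  by (simp add: Neg_def hom_group_def Hom_def)

lemma Plus_Neg:
  assumes "f \<in> Hom C X Y"
  shows "Plus C f (Neg C f) = ZeroMor C X Y"
  using group.r_inv[OF hom_group_group[OF Hom_Obj[OF category_axioms assms]], of f] assms
  by (simp add: Neg_def hom_group_def Hom_def)

lemma Plus_Neg_eq_ZeroMor: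
  assumes f: "f \<in> Hom C X Y" and g: "g \<in> Hom C X Y" and "Plus C f (Neg C g) = ZeroMor C X Y"
  shows "f = g"
  using group.right_cancel[OF hom_group_group[OF Hom_Obj[OF category_axioms f]], of "Neg C g" f g]
    assms Neg_Hom[OF g] Plus_Neg[OF g] by (simp add: hom_group_def)

lemma Plus_ZeroMor_right:
  assumes f: "f \<in> Hom C X Y"
  shows "Plus C f (ZeroMor C X Y) = f"
  using monoid.r_one[OF group.is_monoid[OF hom_group_group[OF Hom_Obj[OF category_axioms f]]], of f] f
  by (simp add: hom_group_def)

lemma Plus_commute:
  assumes f: "f \<in> Hom C X Y" and g: "g \<in> Hom C X Y"
  shows "Plus C f g = Plus C g f"
  using comm_monoid.m_comm[OF comm_group.axioms(1)[OF hom_comm_group[OF Hom_Obj[OF category_axioms f]]], of f g]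
   f g by (simp add: hom_group_def)

lemma is_biproduct_commute:
  assumes "is_biproduct C X Y B"
  shows "is_biproduct C Y X B"
proof -
  from assms obtain i j p q where h: "i \<in> Hom C X B" "j \<in> Hom C Y B" "p \<in> Hom C B X" "q \<in> Hom C B Y"
    "p \<cdot> i = Ident C X" "q \<cdot> j = Ident C Y" "p \<cdot> j = ZeroMor C Y X" "q \<cdot> i = ZeroMor C X Y"
    "Plus C (i \<cdot> p) (j \<cdot> q) = Ident C B" "X \<in> Obj C" "Y \<in> Obj C" "B \<in> Obj C"
    unfolding is_biproduct_def by blast
  then have "Plus C (j \<cdot> q) (i \<cdot> p) = Ident C B"
    using Plus_commute[OF Comp_closed[OF h(3,1)] Comp_closed[OF h(4,2)]] by simp
  then show ?thesis unfolding is_biproduct_def using h by blast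
qed

end

lemma additive_functor_ZeroMor:
  assumes C: "additive_category C" and D: "additive_category D"
    and F: "is_additive_functor C D FO FM" and X: "X \<in> Obj C" "Y \<in> Obj C"
  shows "FM (ZeroMor C X Y) = ZeroMor D (FO X) (FO Y)"
proof -
  interpret C: additive_category C by fact
  interpret D: additive_category D by fact
  have "FM (ZeroMor C X Y) \<in> Hom D (FO X) (FO Y)"
    using F C.ZeroMor_Hom[OF X] functor_Hom[OF C.category_axioms] unfolding is_additive_functor_def by blast
  moreover have "Plus D (FM (ZeroMor C X Y)) (FM (ZeroMor C X Y)) = FM (ZeroMor C X Y)"
    using F C.ZeroMor_Hom[OF X] C.Plus_ZeroMor[OF X] X unfolding is_additive_functor_def by metis
  ultimately show ?thesis by (rule D.idem_ZeroMor)
qed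

lemma additive_functor_zero_object:
  assumes C: "additive_category C" and D: "additive_category D"
    and F: "is_additive_functor C D FO FM" and Z: "is_zero_object C Z"
  shows "is_zero_object D (FO Z)"
  using assms additive_functor_ZeroMor[OF C D F, of Z Z]
  unfolding additive_category.is_zero_object_iff[OF C] additive_category.is_zero_object_iff[OF D]
  unfolding is_additive_functor_def is_functor_def by metis

lemma additive_functor_biproduct:
  assumes C: "additive_category C" and D: "additive_category D"
    and F: "is_additive_functor C D FO FM" and B: "is_biproduct C X Y B"
  shows "is_biproduct D (FO X) (FO Y) (FO B)"
proof -
  interpret C: additive_category C by fact
  from B obtain i j p q where h: "i \<in> Hom C X B" "j \<in> Hom C Y B" "p \<in> Hom C B X" "q \<in> Hom C B Y"
    "p \<cdot>\<^bsub>C\<^esub> i = Ident C X" "q \<cdot>\<^bsub>C\<^esub> j = Ident C Y"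
    "p \<cdot>\<^bsub>C\<^esub> j = ZeroMor C Y X" "q \<cdot>\<^bsub>C\<^esub> i = ZeroMor C X Y"
    "Plus C (i \<cdot>\<^bsub>C\<^esub> p) (j \<cdot>\<^bsub>C\<^esub> q) = Ident C B" and O: "X \<in> Obj C" "Y \<in> Obj C" "B \<in> Obj C"
    unfolding is_biproduct_def by blast
  have F': "is_functor C D FO FM" using F unfolding is_additive_functor_def by blast
  note Hom = functor_Hom[OF C.category_axioms F'] and Comp = functor_Comp[OF C.category_axioms F', symmetric]
  note Zero = additive_functor_ZeroMor[OF C D F]
  have Id: "FM (Ident C A) = Ident D (FO A)" "FO A \<in> Obj D" if "A \<in> Obj C" for A
    using F' that unfolding is_functor_def by auto
  have "Plus D (FM (i \<cdot>\<^bsub>C\<^esub> p)) (FM (j \<cdot>\<^bsub>C\<^esub> q)) = FM (Ident C B)"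
    using F C.Comp_closed[OF h(3,1)] C.Comp_closed[OF h(4,2)] O h(9) unfolding is_additive_functor_def by metis
  then have "Plus D (FM i \<cdot>\<^bsub>D\<^esub> FM p) (FM j \<cdot>\<^bsub>D\<^esub> FM q) = Ident D (FO B)"
    by (simp add: Comp[OF h(3,1)] Comp[OF h(4,2)] Id O)
  moreover have "FM p \<cdot>\<^bsub>D\<^esub> FM i = Ident D (FO X)" "FM q \<cdot>\<^bsub>D\<^esub> FM j = Ident D (FO Y)"
    "FM p \<cdot>\<^bsub>D\<^esub> FM j = ZeroMor D (FO Y) (FO X)" "FM q \<cdot>\<^bsub>D\<^esub> FM i = ZeroMor D (FO X) (FO Y)"
    by (simp_all add: Comp[OF h(1,3)] Comp[OF h(2,4)] Comp[OF h(2,3)] Comp[OF h(1,4)] h Id O Zero)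
  ultimately show ?thesis
    unfolding is_biproduct_def using Id(2) O Hom h(1-4) by blast
qed

section \<open>Split triangles and thick subcategories\<close>

context triangulated_category
begin

lemma dist_triangle_Hom:
  assumes "is_dist_triangle C X Y Z f g h"
  shows "f \<in> Hom C X Y" "g \<in> Hom C Y Z" "h \<in> Hom C Z (Susp C X)"
  using assms by (auto simp: is_dist_triangle_def is_triangle_def)

lemma dist_triangle_rotate:
  "is_dist_triangle C X Y Z f g h \<Longrightarrow> is_dist_triangle C Y Z (Susp C X) g h (Neg C (SuspMor C f))"
  using TR2[of X Y Z f g h] by (simp add: is_dist_triangle_def)

lemma Susp_Hom: "f \<in> Hom C X Y \<Longrightarrow> SuspMor C f \<in> Hom C (Susp C X) (Susp C Y)"
  using functor_Hom[OF category_axioms] Susp_additive unfolding is_additive_functor_def by blast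

lemma Susp_Obj: "X \<in> Obj C \<Longrightarrow> Susp C X \<in> Obj C"
  using Susp_additive unfolding is_additive_functor_def is_functor_def by blast

text \<open>The rotation of this triangle is the one of TR1 for the zero object \<open>\<Sigma>N\<close>.\<close>

lemma dist_triangle_zero_Ident:
  assumes W: "W \<in> Obj C" and N: "is_zero_object C N"
  shows "is_dist_triangle C N W W (ZeroMor C N W) (Ident C W) (ZeroMor C W (Susp C N))"
proof -
  have SN: "is_zero_object C (Susp C N)"
    by (rule additive_functor_zero_object[OF additive_category_axioms additive_category_axioms Susp_additive N])
  have NO: "N \<in> Obj C" using N by (simp add: is_zero_object_def)
  have "Neg C (SuspMor C (ZeroMor C N W)) \<in> Hom C (Susp C N) (Susp C W)"
    by (intro Neg_Hom Susp_Hom ZeroMor_Hom NO W)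
  then have "Neg C (SuspMor C (ZeroMor C N W)) = ZeroMor C (Susp C N) (Susp C W)"
    using SN ZeroMor_Hom[of "Susp C N" "Susp C W"] Susp_Obj NO W unfolding is_zero_object_def by blast
  moreover have "is_triangle C N W W (ZeroMor C N W) (Ident C W) (ZeroMor C W (Susp C N))"
    unfolding is_triangle_def using ZeroMor_Hom Ident_closed NO W Susp_Obj by blast
  ultimately show ?thesis
    using TR2 TR1_Ident[OF W SN] by simp
qed

text \<open>A map \<open>\<phi>\<close> that vanishes on \<open>f\<close> is a map of the first two terms to the triangle \<open>N \<rightarrow> W \<rightarrow> W\<close> with \<open>N\<close> a zero
  object, which TR3 completes to a map of triangles.\<close>

lemma weak_cokernel:
  assumes T: "is_dist_triangle C X Y Z f g h" and \<phi>: "\<phi> \<in> Hom C Y W" and 0: "\<phi> \<cdot> f = ZeroMor C X W"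
  shows "\<exists>c \<in> Hom C Z W. c \<cdot> g = \<phi>"
proof -
  obtain N where N: "is_zero_object C N" using ex_zero_object by blast
  have O: "N \<in> Obj C" "X \<in> Obj C" "W \<in> Obj C"
    using N Hom_Obj[OF category_axioms dist_triangle_Hom(1)[OF T]] Hom_Obj[OF category_axioms \<phi>]
    by (auto simp: is_zero_object_def)
  have "\<phi> \<cdot> f = ZeroMor C N W \<cdot> ZeroMor C X N"
    using ZeroMor_Comp[OF ZeroMor_Hom[OF O(2,1)] O(3)] 0 by simp
  from TR3[OF T dist_triangle_zero_Ident[OF O(3) N] ZeroMor_Hom[OF O(2,1)] \<phi> this]
  obtain c where "c \<in> Hom C Z W" "c \<cdot> g = Ident C W \<cdot> \<phi>" by blast
  then show ?thesis using Comp_Ident_left[OF \<phi>] by auto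
qed

text \<open>A retraction \<open>p\<close> gives a map of triangles to \<open>X \<rightarrow> X \<rightarrow> N\<close> that is the identity on \<open>X\<close>. By
  commutativity of its last square, \<open>h\<close> factors through the zero object \<open>N\<close>.\<close>

lemma split_mono_connecting_zero:
  assumes T: "is_dist_triangle C X Y Z f g h" and p: "p \<in> Hom C Y X" "p \<cdot> f = Ident C X"
  shows "h = ZeroMor C Z (Susp C X)"
proof -
  obtain N where N: "is_zero_object C N" using ex_zero_object by blast
  note H = dist_triangle_Hom[OF T]
  have O: "X \<in> Obj C" using Hom_Obj[OF category_axioms H(1)] by simp
  note Id = Ident_closed[OF O]
  have "p \<cdot> f = Ident C X \<cdot> Ident C X" using p(2) Comp_Ident_left[OF Id] by simp
  from TR3[OF T TR1_Ident[OF O N] Id p(1) this] obtain c where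
    c: "c \<in> Hom C Z N" "SuspMor C (Ident C X) \<cdot> h = ZeroMor C N (Susp C X) \<cdot> c" by blast
  have "SuspMor C (Ident C X) = Ident C (Susp C X)"
    using Susp_additive O unfolding is_additive_functor_def is_functor_def by blast
  then show ?thesis
    using c(2) Comp_Ident_left[OF H(3)] ZeroMor_Comp[OF c(1) Susp_Obj[OF O]] by simp
qed

text \<open>The difference of \<open>u\<close> and \<open>v\<close> vanishes on \<open>g\<close>, so in the rotated triangle it factors through the zero map
  \<open>Z \<rightarrow> \<Sigma>X\<close>.\<close>

lemma split_triangle_epi:
  assumes T: "is_dist_triangle C X Y Z f g (ZeroMor C Z (Susp C X))"
    and "u \<in> Hom C Z W" "v \<in> Hom C Z W" "u \<cdot> g = v \<cdot> g"
  shows "u = v"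
proof -
  note H = dist_triangle_Hom[OF T]
  note T' = dist_triangle_rotate[OF T]
  have O: "Z \<in> Obj C" "W \<in> Obj C" "Y \<in> Obj C"
    using Hom_Obj[OF category_axioms H(2)] Hom_Obj[OF category_axioms assms(2)] by auto
  let ?d = "Plus C u (Neg C v)"
  have n: "Neg C v \<in> Hom C Z W" by (rule Neg_Hom) fact
  have d: "?d \<in> Hom C Z W"
    using monoid.m_closed[OF group.is_monoid[OF hom_group_group[OF O(1,2)]], of u "Neg C v"]
      n assms(2) by (simp add: hom_group_def)
  have "?d \<cdot> g = Plus C v (Neg C v) \<cdot> g"
    using Comp_Plus_left[OF H(2) assms(2) n] Comp_Plus_left[OF H(2) assms(3) n] assms(4) by simp
  then have "?d \<cdot> g = ZeroMor C Y W"
    using Plus_Neg[OF assms(3)] ZeroMor_Comp[OF H(2) O(2)] by simp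
  from weak_cokernel[OF T' d this] obtain c where
    c: "c \<in> Hom C (Susp C X) W" "c \<cdot> ZeroMor C Z (Susp C X) = ?d" by blast
  then have "?d = ZeroMor C Z W" using Comp_ZeroMor[OF c(1) O(1)] by simp
  then show ?thesis using Plus_Neg_eq_ZeroMor assms(2,3) by blast
qed

text \<open>The cone of the inclusion of a summand is the other summand: the projection \<open>q\<close> induces \<open>c: Z \<rightarrow> Y\<close>
  with \<open>c g = q\<close>, and \<open>g j\<close> is its inverse. One composite is \<open>q j = 1\<close>; the other one is the identity since
  it is so after composition with the epimorphism \<open>g\<close>.\<close>

lemma biproduct_cone_isomorphic:
  assumes i: "i \<in> Hom C X B" "j \<in> Hom C Y B" "p \<in> Hom C B X" "q \<in> Hom C B Y"
        "p \<cdot> i = Ident C X" "q \<cdot> j = Ident C Y" "q \<cdot> i = ZeroMor C X Y"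
        "Plus C (i \<cdot> p) (j \<cdot> q) = Ident C B"
    and T: "is_dist_triangle C X B Z i g h"
  shows "isomorphic C Z Y"
proof -
  note g = dist_triangle_Hom(2)[OF T] and h = dist_triangle_Hom(3)[OF T]
  have O: "X \<in> Obj C" "B \<in> Obj C" "Y \<in> Obj C" "Z \<in> Obj C"
    using Hom_Obj[OF category_axioms i(1)] Hom_Obj[OF category_axioms i(2)] Hom_Obj[OF category_axioms g] by auto
  have T0: "is_dist_triangle C X B Z i g (ZeroMor C Z (Susp C X))"
    using T split_mono_connecting_zero[OF T i(3,5)] by simp
  obtain c where c: "c \<in> Hom C Z Y" "c \<cdot> g = q"
    using weak_cokernel[OF T i(4,7)] by blast
  note gj = Comp_closed[OF i(2) g]
  have cgj: "c \<cdot> (g \<cdot> j) = Ident C Y"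
    using Comp_assoc[OF i(2) g c(1)] c(2) i(6) by simp
  \<comment> \<open>Consecutive maps in a triangle compose to zero: TR3 applied to the triangle of the identity of \<open>X\<close>.\<close>
  have gi: "g \<cdot> i = ZeroMor C X Z"
  proof -
    obtain N where N: "is_zero_object C N" using ex_zero_object by blast
    have "i \<cdot> Ident C X = i \<cdot> Ident C X" ..
    from TR3[OF TR1_Ident[OF O(1) N] T Ident_closed[OF O(1)] i(1) this]
    obtain e where e: "e \<in> Hom C N Z" "e \<cdot> ZeroMor C X N = g \<cdot> i" by blast
    then show ?thesis using Comp_ZeroMor[OF e(1) O(1)] by simp
  qed
  have "((g \<cdot> j) \<cdot> c) \<cdot> g = g \<cdot> (j \<cdot> q)"
    using Comp_assoc[OF g c(1) gj] Comp_assoc[OF i(4,2) g] c(2) by simp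
  also have "\<dots> = Plus C (ZeroMor C B Z) (g \<cdot> (j \<cdot> q))"
    using Plus_commute[OF ZeroMor_Hom[OF O(2,4)] Comp_closed[OF Comp_closed[OF i(4,2)] g]]
      Plus_ZeroMor_right[OF Comp_closed[OF Comp_closed[OF i(4,2)] g]] by simp
  also have "\<dots> = Plus C (g \<cdot> (i \<cdot> p)) (g \<cdot> (j \<cdot> q))"
    using Comp_assoc[OF i(3,1) g] gi ZeroMor_Comp[OF i(3) O(4)] by simp
  also have "\<dots> = Ident C Z \<cdot> g"
    using Comp_Plus_right[OF Comp_closed[OF i(3,1)] Comp_closed[OF i(4,2)] g] i(8)
      Comp_Ident_left[OF g] Comp_Ident_right[OF g] by simp
  finally have "(g \<cdot> j) \<cdot> c = Ident C Z"
    by (intro split_triangle_epi[OF T0 Comp_closed[OF c(1) gj] Ident_closed[OF O(4)]])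
  then show ?thesis
    unfolding isomorphic_def is_iso_def using c(1) gj cgj by blast
qed

text \<open>Rotating twice makes \<open>\<Sigma>Y\<close> the cone of a map from \<open>Z\<close> to \<open>\<Sigma>X\<close>.\<close>

lemma thick_subcategory_middle:
  assumes J: "thick_subcategory C J" and T: "is_dist_triangle C X Y Z f g h" and "X \<in> J" "Z \<in> J"
  shows "Y \<in> J"
proof -
  have O: "X \<in> Obj C" "Y \<in> Obj C"
    using Hom_Obj[OF category_axioms dist_triangle_Hom(1)[OF T]] by auto
  have S: "Susp C A \<in> J \<longleftrightarrow> A \<in> J" if "A \<in> Obj C" for A
    using J that unfolding thick_subcategory_def by blast
  have "Susp C Y \<in> J"
    using J dist_triangle_rotate[OF dist_triangle_rotate[OF T]] S O assms(3,4)
    unfolding thick_subcategory_def by blast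
  then show ?thesis using S O by blast
qed

text \<open>Closure under summands is part of thickness. Closure under biproducts follows from the triangle
  \<open>X \<rightarrow> B \<rightarrow> Z\<close> on the inclusion of \<open>X\<close>, where \<open>Z\<close> is isomorphic to \<open>Y\<close>.\<close>

lemma thick_subcategory_biproduct:
  assumes J: "thick_subcategory C J" and B: "is_biproduct C X Y B"
  shows "B \<in> J \<longleftrightarrow> X \<in> J \<and> Y \<in> J"
proof
  assume "B \<in> J"
  then show "X \<in> J \<and> Y \<in> J"
    using J B is_biproduct_commute[OF B] unfolding thick_subcategory_def by blast
next
  assume XY: "X \<in> J \<and> Y \<in> J"
  from B obtain i j p q where h: "i \<in> Hom C X B" "j \<in> Hom C Y B" "p \<in> Hom C B X" "q \<in> Hom C B Y"
    "p \<cdot> i = Ident C X" "q \<cdot> j = Ident C Y" "q \<cdot> i = ZeroMor C X Y"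
    "Plus C (i \<cdot> p) (j \<cdot> q) = Ident C B"
    unfolding is_biproduct_def by blast
  obtain Z g k where T: "is_dist_triangle C X B Z i g k" using TR1_cone[OF h(1)] by blast
  have "Z \<in> Obj C" using Hom_Obj[OF category_axioms dist_triangle_Hom(2)[OF T]] by simp
  then have "Z \<in> J"
    using isomorphic_sym[OF biproduct_cone_isomorphic[OF h T]] J XY unfolding thick_subcategory_def by blast
  then show "B \<in> J" using thick_subcategory_middle[OF J T] XY by blast
qed

end

lemma thick_subcategory_vimage:
  assumes C: "triangulated_category C" and D: "triangulated_category D"
    and F: "is_exact_functor C D FO FM" and J: "thick_subcategory D J"
  shows "thick_subcategory C {X \<in> Obj C. FO X \<in> J}"
proof -
  interpret C: triangulated_category C by fact
  interpret D: triangulated_category D by fact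
  have add: "is_additive_functor C D FO FM" and F': "is_functor C D FO FM"
    using F unfolding is_exact_functor_def is_additive_functor_def by blast+
  obtain \<theta> where \<theta>: "\<And>X. X \<in> Obj C \<Longrightarrow> is_iso D (FO (Susp C X)) (Susp D (FO X)) (\<theta> X)"
    and tri: "\<And>X Y Z f g h. is_dist_triangle C X Y Z f g h \<Longrightarrow>
             is_dist_triangle D (FO X) (FO Y) (FO Z) (FM f) (FM g) (\<theta> X \<cdot>\<^bsub>D\<^esub> FM h)"
    using F unfolding is_exact_functor_def is_natural_iso_def by blast
  have O: "FO X \<in> Obj D" if "X \<in> Obj C" for X using F' that unfolding is_functor_def by blast
  have iso: "X \<in> J \<longleftrightarrow> Y \<in> J" if "isomorphic D X Y" "X \<in> Obj D" "Y \<in> Obj D" for X Y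
    using J that isomorphic_sym[OF that(1)] unfolding thick_subcategory_def by blast
  have S: "FO (Susp C X) \<in> J \<longleftrightarrow> FO X \<in> J" if X: "X \<in> Obj C" for X
  proof -
    have "FO (Susp C X) \<in> J \<longleftrightarrow> Susp D (FO X) \<in> J"
      using \<theta>[OF X] O X C.Susp_Obj D.Susp_Obj by (intro iso) (auto simp: isomorphic_def)
    then show ?thesis using J O[OF X] unfolding thick_subcategory_def by blast
  qed
  show ?thesis
    unfolding thick_subcategory_def
  proof (intro conjI)
    show "\<forall>Z. is_zero_object C Z \<longrightarrow> Z \<in> {X \<in> Obj C. FO X \<in> J}"
    proof (intro allI impI)
      fix Z assume Z: "is_zero_object C Z"
      have "FO Z \<in> J"
        using additive_functor_zero_object[OF C.additive_category_axioms D.additive_category_axioms add Z] J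
        unfolding thick_subcategory_def by blast
      then show "Z \<in> {X \<in> Obj C. FO X \<in> J}"
        using Z by (simp add: is_zero_object_def)
    qed
    show "\<forall>X \<in> {X \<in> Obj C. FO X \<in> J}. \<forall>Y \<in> Obj C. isomorphic C X Y \<longrightarrow> Y \<in> {X \<in> Obj C. FO X \<in> J}"
    proof (intro ballI impI)
      fix X Y assume X: "X \<in> {X \<in> Obj C. FO X \<in> J}" and Y: "Y \<in> Obj C" and "isomorphic C X Y"
      from functor_isomorphic[OF C.category_axioms F' this(3)] have "FO X \<in> J \<longleftrightarrow> FO Y \<in> J"
        using X Y by (intro iso O) auto
      then show "Y \<in> {X \<in> Obj C. FO X \<in> J}" using X Y by simp
    qed
    show "\<forall>X \<in> Obj C. Susp C X \<in> {X \<in> Obj C. FO X \<in> J} \<longleftrightarrow> X \<in> {X \<in> Obj C. FO X \<in> J}"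
      using S C.Susp_Obj by simp
    show "\<forall>X Y Z f g h. is_dist_triangle C X Y Z f g h \<and> X \<in> {X \<in> Obj C. FO X \<in> J} \<and> Y \<in> {X \<in> Obj C. FO X \<in> J}
      \<longrightarrow> Z \<in> {X \<in> Obj C. FO X \<in> J}"
    proof (intro allI impI, elim conjE)
      fix X Y Z f g h
      assume T: "is_dist_triangle C X Y Z f g h" and "X \<in> {X \<in> Obj C. FO X \<in> J}" "Y \<in> {X \<in> Obj C. FO X \<in> J}"
      then have "FO X \<in> J" "FO Y \<in> J" by auto
      with tri[OF T] have "FO Z \<in> J" using J unfolding thick_subcategory_def by blast
      then show "Z \<in> {X \<in> Obj C. FO X \<in> J}"
        using Hom_Obj[OF C.category_axioms C.dist_triangle_Hom(2)[OF T]] by simp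
    qed
    show "\<forall>X Y B. is_biproduct C X Y B \<and> B \<in> {X \<in> Obj C. FO X \<in> J} \<longrightarrow> X \<in> {X \<in> Obj C. FO X \<in> J}"
    proof (intro allI impI, elim conjE)
      fix X Y B assume B: "is_biproduct C X Y B" "B \<in> {X \<in> Obj C. FO X \<in> J}"
      then have "FO X \<in> J"
        using additive_functor_biproduct[OF C.additive_category_axioms D.additive_category_axioms add B(1)] J
        unfolding thick_subcategory_def by blast
      then show "X \<in> {X \<in> Obj C. FO X \<in> J}" using B by (simp add: is_biproduct_def)
    qed
  qed simp
qed

section \<open>Thick tensor ideals and their generation\<close>

definition generated_ideal ::
  "('o, 'm, 'x) monoidal_triangulated_data_scheme \<Rightarrow> 'o set \<Rightarrow> 'o set" where
  "generated_ideal C A = \<Inter>{J. thick_tensor_ideal C J \<and> A \<subseteq> J}"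

lemma thick_tensor_ideal_subset: "thick_tensor_ideal C J \<Longrightarrow> J \<subseteq> Obj C"
  by (simp add: thick_tensor_ideal_def thick_subcategory_def)

lemma generated_ideal_superset: "A \<subseteq> generated_ideal C A"
  unfolding generated_ideal_def by blast

lemma generated_ideal_least: "\<lbrakk>thick_tensor_ideal C J; A \<subseteq> J\<rbrakk> \<Longrightarrow> generated_ideal C A \<subseteq> J"
  unfolding generated_ideal_def by blast

lemma generated_ideal_mono: "A \<subseteq> B \<Longrightarrow> generated_ideal C A \<subseteq> generated_ideal C B"
  unfolding generated_ideal_def by blast

lemma thick_subcategory_Inter:
  assumes "A \<noteq> {}" and thick: "\<And>J. J \<in> A \<Longrightarrow> thick_subcategory C J"
  shows "thick_subcategory C (\<Inter>A)"
  unfolding thick_subcategory_def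
proof (intro conjI)
  have "J \<subseteq> Obj C" if "J \<in> A" for J
    using thick[OF that] unfolding thick_subcategory_def by blast
  then show "\<Inter>A \<subseteq> Obj C" using assms(1) by blast
  have "Z \<in> K" if "K \<in> A" "is_zero_object C Z" for K Z
    using thick[OF that(1)] that(2) unfolding thick_subcategory_def by blast
  then show "\<forall>Z. is_zero_object C Z \<longrightarrow> Z \<in> \<Inter>A" by blast
  have "Y \<in> K" if "K \<in> A" "X \<in> K" "Y \<in> Obj C" "isomorphic C X Y" for K X Y
    using thick[OF that(1)] that(2-) unfolding thick_subcategory_def by blast
  then show "\<forall>X \<in> \<Inter>A. \<forall>Y \<in> Obj C. isomorphic C X Y \<longrightarrow> Y \<in> \<Inter>A"
    by (intro ballI impI InterI) (meson InterE)
  have "Susp C X \<in> K \<longleftrightarrow> X \<in> K" if "K \<in> A" "X \<in> Obj C" for K X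
    using thick[OF that(1)] that(2) unfolding thick_subcategory_def by blast
  then show "\<forall>X \<in> Obj C. Susp C X \<in> \<Inter>A \<longleftrightarrow> X \<in> \<Inter>A" by blast
  have "Z \<in> K" if "K \<in> A" "is_dist_triangle C X Y Z f g h" "X \<in> K" "Y \<in> K"
    for K X Y Z f g h
    using thick[OF that(1)] that(2-) unfolding thick_subcategory_def by blast
  then show "\<forall>X Y Z f g h. is_dist_triangle C X Y Z f g h \<and> X \<in> \<Inter>A \<and> Y \<in> \<Inter>A \<longrightarrow> Z \<in> \<Inter>A"
    by (intro allI impI InterI) (meson InterE)
  have "X \<in> K" if "K \<in> A" "is_biproduct C X Y B" "B \<in> K" for K X Y B
    using thick[OF that(1)] that(2-) unfolding thick_subcategory_def by blast
  then show "\<forall>X Y B. is_biproduct C X Y B \<and> B \<in> \<Inter>A \<longrightarrow> X \<in> \<Inter>A"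
    by (intro allI impI InterI) (meson InterE)
qed

text \<open>Each closure condition involves finitely many objects, and directedness puts them into one member.
  The triangle condition is the one with two hypotheses.\<close>

lemma thick_subcategory_directed_Union:
  assumes "\<D> \<noteq> {}" and thick: "\<And>J. J \<in> \<D> \<Longrightarrow> thick_subcategory C J"
    and dir: "\<And>I J. \<lbrakk>I \<in> \<D>; J \<in> \<D>\<rbrakk> \<Longrightarrow> \<exists>K \<in> \<D>. I \<subseteq> K \<and> J \<subseteq> K"
  shows "thick_subcategory C (\<Union>\<D>)"
  unfolding thick_subcategory_def
proof (intro conjI)
  have "J \<subseteq> Obj C" if "J \<in> \<D>" for J
    using thick[OF that] unfolding thick_subcategory_def by blast
  then show "\<Union>\<D> \<subseteq> Obj C" by blast
  have "Z \<in> K" if "K \<in> \<D>" "is_zero_object C Z" for K Z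
    using thick[OF that(1)] that(2) unfolding thick_subcategory_def by blast
  then show "\<forall>Z. is_zero_object C Z \<longrightarrow> Z \<in> \<Union>\<D>" using assms(1) by blast
  have "Y \<in> K" if "K \<in> \<D>" "X \<in> K" "Y \<in> Obj C" "isomorphic C X Y" for K X Y
    using thick[OF that(1)] that(2-) unfolding thick_subcategory_def by blast
  then show "\<forall>X \<in> \<Union>\<D>. \<forall>Y \<in> Obj C. isomorphic C X Y \<longrightarrow> Y \<in> \<Union>\<D>" by blast
  have "Susp C X \<in> K \<longleftrightarrow> X \<in> K" if "K \<in> \<D>" "X \<in> Obj C" for K X
    using thick[OF that(1)] that(2) unfolding thick_subcategory_def by blast
  then show "\<forall>X \<in> Obj C. Susp C X \<in> \<Union>\<D> \<longleftrightarrow> X \<in> \<Union>\<D>" by blast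
  have cone: "Z \<in> K" if "K \<in> \<D>" "is_dist_triangle C X Y Z f g h" "X \<in> K" "Y \<in> K" for K X Y Z f g h
    using thick[OF that(1)] that(2-) unfolding thick_subcategory_def by blast
  show "\<forall>X Y Z f g h. is_dist_triangle C X Y Z f g h \<and> X \<in> \<Union>\<D> \<and> Y \<in> \<Union>\<D> \<longrightarrow> Z \<in> \<Union>\<D>"
  proof (intro allI impI, elim conjE UnionE)
    fix X Y Z f g h I J
    assume T: "is_dist_triangle C X Y Z f g h" and XY: "X \<in> I" "I \<in> \<D>" "Y \<in> J" "J \<in> \<D>"
    then obtain K where "K \<in> \<D>" "X \<in> K" "Y \<in> K" using dir[of I J] by blast
    then show "Z \<in> \<Union>\<D>" using cone[OF _ T] by blast
  qed
  have "X \<in> K" if "K \<in> \<D>" "is_biproduct C X Y B" "B \<in> K" for K X Y B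
    using thick[OF that(1)] that(2-) unfolding thick_subcategory_def by blast
  then show "\<forall>X Y B. is_biproduct C X Y B \<and> B \<in> \<Union>\<D> \<longrightarrow> X \<in> \<Union>\<D>" by blast
qed

lemma thick_tensor_ideal_directed_Union:
  assumes "\<D> \<noteq> {}" and ideal: "\<And>J. J \<in> \<D> \<Longrightarrow> thick_tensor_ideal C J"
    and "\<And>I J. \<lbrakk>I \<in> \<D>; J \<in> \<D>\<rbrakk> \<Longrightarrow> \<exists>K \<in> \<D>. I \<subseteq> K \<and> J \<subseteq> K"
  shows "thick_tensor_ideal C (\<Union>\<D>)"
proof -
  have "thick_subcategory C (\<Union>\<D>)"
    using assms by (intro thick_subcategory_directed_Union) (auto simp: thick_tensor_ideal_def)
  then show ?thesis
    using ideal unfolding thick_tensor_ideal_def by blast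
qed

context monoidal_triangulated_category
begin

lemma thick_tensor_ideal_generated: "A \<subseteq> Obj C \<Longrightarrow> thick_tensor_ideal C (generated_ideal C A)"
  unfolding generated_ideal_def using thick_tensor_ideal_Obj by (intro thick_tensor_ideal_Inter) auto

lemma thick_tensor_ideal_isomorphic:
  assumes "thick_tensor_ideal C J" "isomorphic C X Y" "X \<in> Obj C" "Y \<in> Obj C"
  shows "X \<in> J \<longleftrightarrow> Y \<in> J"
  using assms(1,3,4) assms(2) isomorphic_sym[OF assms(2)]
  unfolding thick_tensor_ideal_def thick_subcategory_def by blast

lemma tensor_assoc_mem:
  assumes "thick_tensor_ideal C J" "X \<in> Obj C" "Y \<in> Obj C" "Z \<in> Obj C"
  shows "(X \<odot> Y) \<odot> Z \<in> J \<longleftrightarrow> X \<odot> (Y \<odot> Z) \<in> J"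
proof (rule thick_tensor_ideal_isomorphic[OF assms(1)])
  show "isomorphic C ((X \<odot> Y) \<odot> Z) (X \<odot> (Y \<odot> Z))"
    using Assoc_iso[OF assms(2-4)] unfolding isomorphic_def by blast
qed (use assms Tens_closed in auto)

text \<open>Since \<open>X \<mapsto> X \<otimes> k\<close> is exact, the conditions for the single \<open>k\<close> cut out thick subcategories. For \<open>x\<close> in the
  residual, \<open>(x \<otimes> y) \<otimes> k\<close> is isomorphic to \<open>x \<otimes> (y \<otimes> k)\<close> with \<open>y \<otimes> k \<in> A\<close>; this is what \<open>mult\<close> is for.\<close>

lemma thick_tensor_ideal_left_residual:
  assumes J: "thick_tensor_ideal C J" and A: "A \<subseteq> Obj C"
    and mult: "\<And>Y k. \<lbrakk>Y \<in> Obj C; k \<in> A\<rbrakk> \<Longrightarrow> Y \<odot> k \<in> A"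
  shows "thick_tensor_ideal C {X \<in> Obj C. \<forall>k \<in> A. X \<odot> k \<in> J}"
  unfolding thick_tensor_ideal_def
proof (intro conjI ballI)
  show "thick_subcategory C {X \<in> Obj C. \<forall>k \<in> A. X \<odot> k \<in> J}"
  proof -
    have JT: "thick_subcategory C J" using J by (simp add: thick_tensor_ideal_def)
    have "thick_subcategory C {X \<in> Obj C. X \<odot> k \<in> J}" if "k \<in> A" for k
      using thick_subcategory_vimage[OF triangulated_category_axioms triangulated_category_axioms
          Tens_exact_left JT] A that by blast
    moreover have "thick_subcategory C (Obj C)"
      using thick_tensor_ideal_Obj by (simp add: thick_tensor_ideal_def)
    ultimately have "thick_subcategory C (\<Inter>(insert (Obj C) ((\<lambda>k. {X \<in> Obj C. X \<odot> k \<in> J}) ` A)))"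
      by (intro thick_subcategory_Inter) blast+
    moreover have "{X \<in> Obj C. \<forall>k \<in> A. X \<odot> k \<in> J} = \<Inter>(insert (Obj C) ((\<lambda>k. {X \<in> Obj C. X \<odot> k \<in> J}) ` A))"
      by blast
    ultimately show ?thesis by simp
  qed
  fix X Y assume X: "X \<in> Obj C" and Y: "Y \<in> {X \<in> Obj C. \<forall>k \<in> A. X \<odot> k \<in> J}"
  have "X \<odot> Y \<odot> k \<in> J \<and> Y \<odot> X \<odot> k \<in> J" if k: "k \<in> A" for k
  proof -
    have kO: "k \<in> Obj C" using k A by blast
    have "X \<odot> (Y \<odot> k) \<in> J" "Y \<odot> (X \<odot> k) \<in> J"
      using J X Y k mult[OF X k] unfolding thick_tensor_ideal_def by blast+
    then show ?thesis using tensor_assoc_mem[OF J] X Y kO by simp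
  qed
  then show "X \<odot> Y \<in> {X \<in> Obj C. \<forall>k \<in> A. X \<odot> k \<in> J}" "Y \<odot> X \<in> {X \<in> Obj C. \<forall>k \<in> A. X \<odot> k \<in> J}"
    using X Y Tens_closed by auto
qed

lemma thick_tensor_ideal_right_residual:
  assumes J: "thick_tensor_ideal C J" and A: "A \<subseteq> Obj C"
    and mult: "\<And>Y k. \<lbrakk>Y \<in> Obj C; k \<in> A\<rbrakk> \<Longrightarrow> k \<odot> Y \<in> A"
  shows "thick_tensor_ideal C {X \<in> Obj C. \<forall>k \<in> A. k \<odot> X \<in> J}"
  unfolding thick_tensor_ideal_def
proof (intro conjI ballI)
  show "thick_subcategory C {X \<in> Obj C. \<forall>k \<in> A. k \<odot> X \<in> J}"
  proof -
    have JT: "thick_subcategory C J" using J by (simp add: thick_tensor_ideal_def)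
    have "thick_subcategory C {X \<in> Obj C. k \<odot> X \<in> J}" if "k \<in> A" for k
      using thick_subcategory_vimage[OF triangulated_category_axioms triangulated_category_axioms
          Tens_exact_right JT] A that by blast
    moreover have "thick_subcategory C (Obj C)"
      using thick_tensor_ideal_Obj by (simp add: thick_tensor_ideal_def)
    ultimately have "thick_subcategory C (\<Inter>(insert (Obj C) ((\<lambda>k. {X \<in> Obj C. k \<odot> X \<in> J}) ` A)))"
      by (intro thick_subcategory_Inter) blast+
    moreover have "{X \<in> Obj C. \<forall>k \<in> A. k \<odot> X \<in> J} = \<Inter>(insert (Obj C) ((\<lambda>k. {X \<in> Obj C. k \<odot> X \<in> J}) ` A))"
      by blast
    ultimately show ?thesis by simp
  qed
  fix X Y assume X: "X \<in> Obj C" and Y: "Y \<in> {X \<in> Obj C. \<forall>k \<in> A. k \<odot> X \<in> J}"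
  have "k \<odot> (X \<odot> Y) \<in> J \<and> k \<odot> (Y \<odot> X) \<in> J" if k: "k \<in> A" for k
  proof -
    have kO: "k \<in> Obj C" using k A by blast
    have "(k \<odot> X) \<odot> Y \<in> J" "(k \<odot> Y) \<odot> X \<in> J"
      using J X Y k mult[OF X k] unfolding thick_tensor_ideal_def by blast+
    then show ?thesis using tensor_assoc_mem[OF J] X Y kO by simp
  qed
  then show "X \<odot> Y \<in> {X \<in> Obj C. \<forall>k \<in> A. k \<odot> X \<in> J}" "Y \<odot> X \<in> {X \<in> Obj C. \<forall>k \<in> A. k \<odot> X \<in> J}"
    using X Y Tens_closed by auto
qed

text \<open>The noncommutative substitute for distributing a product over sums of ideals: fix one factor,
  observe that the admissible other factors form an ideal, and do this once on each side. The residual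
  on the right is an ideal because the generated ideal on the left is already closed under tensoring.\<close>

lemma generated_ideal_tensor:
  assumes J: "thick_tensor_ideal C J" and A: "A \<subseteq> Obj C" and B: "B \<subseteq> Obj C"
    and B_mult: "\<And>X b. \<lbrakk>X \<in> Obj C; b \<in> B\<rbrakk> \<Longrightarrow> X \<odot> b \<in> B"
    and AB: "\<And>a b. \<lbrakk>a \<in> A; b \<in> B\<rbrakk> \<Longrightarrow> a \<odot> b \<in> J"
    and xy: "x \<in> generated_ideal C A" "y \<in> generated_ideal C B"
  shows "x \<odot> y \<in> J"
proof -
  have "generated_ideal C A \<subseteq> {X \<in> Obj C. \<forall>b \<in> B. X \<odot> b \<in> J}"
    using A AB by (intro generated_ideal_least thick_tensor_ideal_left_residual[OF J B B_mult]) auto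
  moreover have gen: "thick_tensor_ideal C (generated_ideal C A)"
    by (rule thick_tensor_ideal_generated[OF A])
  then have "thick_tensor_ideal C {X \<in> Obj C. \<forall>a \<in> generated_ideal C A. a \<odot> X \<in> J}"
    by (intro thick_tensor_ideal_right_residual[OF J thick_tensor_ideal_subset])
      (auto simp: thick_tensor_ideal_def)
  ultimately have "generated_ideal C B \<subseteq> {X \<in> Obj C. \<forall>a \<in> generated_ideal C A. a \<odot> X \<in> J}"
    using B by (intro generated_ideal_least) auto
  then show ?thesis using xy by auto
qed

lemma le_semiprime_lattice: "I \<sqsubseteq>\<^bsub>semiprime_lattice C\<^esub> J \<longleftrightarrow> I \<subseteq> J"
  by (simp add: semiprime_lattice_def)

lemma meet_semiprime_lattice:
  assumes "semiprime_ideal C I" "semiprime_ideal C J"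
  shows "I \<sqinter>\<^bsub>semiprime_lattice C\<^esub> J = I \<inter> J"
proof -
  interpret L: complete_lattice "semiprime_lattice C" by (rule complete_lattice_semiprime_lattice)
  have IJ: "I \<in> carrier (semiprime_lattice C)" "J \<in> carrier (semiprime_lattice C)"
    using assms by (auto simp: semiprime_lattice_def)
  have "semiprime_ideal C (I \<inter> J)"
    using semiprime_ideal_Inter[of "{I, J}" C] assms by auto
  then have "I \<inter> J \<subseteq> I \<sqinter>\<^bsub>semiprime_lattice C\<^esub> J"
    using L.meet_le[OF _ _ IJ, of "I \<inter> J"] by (simp add: semiprime_lattice_def)
  moreover have "I \<sqinter>\<^bsub>semiprime_lattice C\<^esub> J \<subseteq> I" "I \<sqinter>\<^bsub>semiprime_lattice C\<^esub> J \<subseteq> J"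
    using L.meet_left[OF IJ] L.meet_right[OF IJ] by (simp_all add: semiprime_lattice_def)
  ultimately show ?thesis by blast
qed

lemma top_semiprime_lattice: "\<top>\<^bsub>semiprime_lattice C\<^esub> = Obj C"
proof -
  interpret L: complete_lattice "semiprime_lattice C" by (rule complete_lattice_semiprime_lattice)
  have "Obj C \<subseteq> \<top>\<^bsub>semiprime_lattice C\<^esub>"
    using L.top_higher[of "Obj C"] semiprime_ideal_Obj by (simp add: semiprime_lattice_def)
  moreover have "\<top>\<^bsub>semiprime_lattice C\<^esub> \<subseteq> Obj C"
    using L.top_closed semiprime_ideal_subset by (auto simp: semiprime_lattice_def)
  ultimately show ?thesis by blast
qed

lemma prime_ideal_thick: "prime_ideal C P \<Longrightarrow> thick_tensor_ideal C P"
  by (simp add: prime_ideal_def)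

text \<open>The intersection of two such sets is the delicate point: \<open>P\<close> meets both \<open>S\<close> and \<open>T\<close> exactly if it contains
  a biproduct of an object of \<open>S\<close> and an object of \<open>T\<close>.\<close>

lemma openin_Spc_nc:
  "openin (Spc_nc C) U \<longleftrightarrow> (\<exists>S \<subseteq> Obj C. U = {P. prime_ideal C P \<and> P \<inter> S \<noteq> {}})"
proof -
  have eq: "{P. prime_ideal C P} - {P. prime_ideal C P \<and> P \<inter> S = {}} = {P. prime_ideal C P \<and> P \<inter> S \<noteq> {}}" for S
    by blast
  have "istopology (\<lambda>U. \<exists>S \<subseteq> Obj C. U = {P. prime_ideal C P \<and> P \<inter> S \<noteq> {}})"
    unfolding istopology_def
  proof (intro conjI allI impI)
    fix U V
    assume "\<exists>S \<subseteq> Obj C. U = {P. prime_ideal C P \<and> P \<inter> S \<noteq> {}}"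
      and "\<exists>S \<subseteq> Obj C. V = {P. prime_ideal C P \<and> P \<inter> S \<noteq> {}}"
    then obtain S T where S: "S \<subseteq> Obj C" "U = {P. prime_ideal C P \<and> P \<inter> S \<noteq> {}}"
      and T: "T \<subseteq> Obj C" "V = {P. prime_ideal C P \<and> P \<inter> T \<noteq> {}}" by blast
    let ?W = "{B. \<exists>s \<in> S. \<exists>t \<in> T. is_biproduct C s t B}"
    have "P \<inter> ?W \<noteq> {} \<longleftrightarrow> P \<inter> S \<noteq> {} \<and> P \<inter> T \<noteq> {}" if P: "prime_ideal C P" for P
    proof -
      have bip: "B \<in> P \<longleftrightarrow> s \<in> P \<and> t \<in> P" if "is_biproduct C s t B" for s t B
        using prime_ideal_thick[OF P] that
        by (intro thick_subcategory_biproduct) (auto simp: thick_tensor_ideal_def)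
      show ?thesis
      proof
        assume "P \<inter> ?W \<noteq> {}"
        then show "P \<inter> S \<noteq> {} \<and> P \<inter> T \<noteq> {}" using bip by blast
      next
        assume "P \<inter> S \<noteq> {} \<and> P \<inter> T \<noteq> {}"
        then obtain s t where st: "s \<in> P" "s \<in> S" "t \<in> P" "t \<in> T" by blast
        then obtain B where "is_biproduct C s t B" using ex_biproduct[of s t] S(1) T(1) by blast
        then show "P \<inter> ?W \<noteq> {}" using bip st by blast
      qed
    qed
    then have "U \<inter> V = {P. prime_ideal C P \<and> P \<inter> ?W \<noteq> {}}" unfolding S(2) T(2) by blast
    moreover have "?W \<subseteq> Obj C" by (auto simp: is_biproduct_def)
    ultimately show "\<exists>S \<subseteq> Obj C. U \<inter> V = {P. prime_ideal C P \<and> P \<inter> S \<noteq> {}}" by blast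
  next
    fix \<K> assume "\<forall>K \<in> \<K>. \<exists>S \<subseteq> Obj C. K = {P. prime_ideal C P \<and> P \<inter> S \<noteq> {}}"
    then obtain S where S: "\<And>K. K \<in> \<K> \<Longrightarrow> S K \<subseteq> Obj C"
      "\<And>K. K \<in> \<K> \<Longrightarrow> K = {P. prime_ideal C P \<and> P \<inter> S K \<noteq> {}}" by metis
    have "\<Union>\<K> = (\<Union>K \<in> \<K>. {P. prime_ideal C P \<and> P \<inter> S K \<noteq> {}})" using S(2) by auto
    also have "\<dots> = {P. prime_ideal C P \<and> P \<inter> (\<Union>(S ` \<K>)) \<noteq> {}}" by blast
    finally have "\<Union>\<K> = {P. prime_ideal C P \<and> P \<inter> (\<Union>(S ` \<K>)) \<noteq> {}}" .
    moreover have "\<Union>(S ` \<K>) \<subseteq> Obj C" using S(1) by blast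
    ultimately show "\<exists>S \<subseteq> Obj C. \<Union>\<K> = {P. prime_ideal C P \<and> P \<inter> S \<noteq> {}}" by blast
  qed
  then show ?thesis unfolding Spc_nc_def eq by simp
qed

lemma topspace_Spc_nc: "topspace (Spc_nc C) = {P. prime_ideal C P}"
proof
  show "topspace (Spc_nc C) \<subseteq> {P. prime_ideal C P}"
    using openin_topspace[of "Spc_nc C"] unfolding openin_Spc_nc by blast
  \<comment> \<open>All primes contain the zero objects, so the whole spectrum is among the prescribed open sets.\<close>
  obtain Z where Z: "is_zero_object C Z" using ex_zero_object by blast
  have "Z \<in> P" if "prime_ideal C P" for P
    using prime_ideal_thick[OF that] Z unfolding thick_tensor_ideal_def thick_subcategory_def by blast
  then have "{P. prime_ideal C P} = {P. prime_ideal C P \<and> P \<inter> {Z} \<noteq> {}}" by blast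
  moreover have "{Z} \<subseteq> Obj C" using Z by (simp add: is_zero_object_def)
  ultimately have "openin (Spc_nc C) {P. prime_ideal C P}" unfolding openin_Spc_nc by blast
  then show "{P. prime_ideal C P} \<subseteq> topspace (Spc_nc C)" by (rule openin_subset)
qed

text \<open>The ideals generated by finite subsets of \<open>A\<close> are directed, so their union is an ideal; it
  contains \<open>A\<close>.\<close>

lemma generated_ideal_finitary:
  assumes A: "A \<subseteq> Obj C" "s \<in> generated_ideal C A"
  shows "\<exists>F. finite F \<and> F \<subseteq> A \<and> s \<in> generated_ideal C F"
proof -
  let ?D = "generated_ideal C ` {F. finite F \<and> F \<subseteq> A}"
  have "thick_tensor_ideal C (\<Union>?D)"
  proof (rule thick_tensor_ideal_directed_Union)
    fix J assume "J \<in> ?D"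
    then show "thick_tensor_ideal C J" using A(1) thick_tensor_ideal_generated by blast
  next
    fix I J assume "I \<in> ?D" "J \<in> ?D"
    then obtain F G where F: "finite F" "F \<subseteq> A" "I = generated_ideal C F"
      and G: "finite G" "G \<subseteq> A" "J = generated_ideal C G" by blast
    then have "generated_ideal C (F \<union> G) \<in> ?D" by blast
    then show "\<exists>K \<in> ?D. I \<subseteq> K \<and> J \<subseteq> K"
      unfolding F(3) G(3) using generated_ideal_mono[of _ "F \<union> G"] by blast
  qed blast
  moreover have "A \<subseteq> \<Union>?D"
  proof
    fix a assume "a \<in> A"
    moreover have "a \<in> generated_ideal C {a}" using generated_ideal_superset[of "{a}" C] by blast
    ultimately show "a \<in> \<Union>?D" by (intro UnionI[of "generated_ideal C {a}"]) auto
  qed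
  ultimately have "generated_ideal C A \<subseteq> \<Union>?D" by (rule generated_ideal_least)
  then show ?thesis using A(2) by blast
qed

end

section \<open>Primes when all ideals are semiprime\<close>

locale all_ideals_semiprime = monoidal_triangulated_category C
  for C :: "('o, 'm, 'x) monoidal_triangulated_data_scheme" (structure) +
  assumes semiprime: "thick_tensor_ideal C J \<Longrightarrow> semiprime_ideal C J"
begin

text \<open>An ideal \<open>P\<close> that is maximal among those that contain \<open>J\<close> but not \<open>s\<close> is prime. Indeed, if \<open>I \<otimes> K\<close> lies in
  \<open>P\<close> while \<open>I\<close> and \<open>K\<close> do not, then \<open>s\<close> lies in the ideals generated by \<open>I \<union> P\<close> and by \<open>K \<union> P\<close>. Their product
  lies in \<open>P\<close>, so that all \<open>s \<otimes> t \<otimes> s\<close> lie in \<open>P\<close>, and semiprimeness of \<open>P\<close> gives the contradiction \<open>s \<in> P\<close>.\<close>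

lemma prime_ideal_separation:
  assumes J: "thick_tensor_ideal C J" and s: "s \<in> Obj C" "s \<notin> J"
  obtains P where "prime_ideal C P" "J \<subseteq> P" "s \<notin> P"
proof -
  let ?A = "{K. thick_tensor_ideal C K \<and> J \<subseteq> K \<and> s \<notin> K}"
  have "\<exists>M \<in> ?A. \<forall>K \<in> ?A. M \<subseteq> K \<longrightarrow> K = M"
  proof (rule subset_Zorn_nonempty)
    show "?A \<noteq> {}" using J s by blast
    fix \<C> assume ne: "\<C> \<noteq> {}" and chain: "subset.chain ?A \<C>"
    have sub: "\<C> \<subseteq> ?A" and lin: "\<And>I K. \<lbrakk>I \<in> \<C>; K \<in> \<C>\<rbrakk> \<Longrightarrow> I \<subseteq> K \<or> K \<subseteq> I"
      using chain unfolding subset_chain_def by blast+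
    have "thick_tensor_ideal C (\<Union>\<C>)"
    proof (rule thick_tensor_ideal_directed_Union[OF ne])
      fix I K assume "I \<in> \<C>" "K \<in> \<C>"
      then show "\<exists>M \<in> \<C>. I \<subseteq> M \<and> K \<subseteq> M" using lin[of I K] by blast
    qed (use sub in blast)
    then show "\<Union>\<C> \<in> ?A" using sub ne by blast
  qed
  then obtain P where "P \<in> ?A" and maximal: "\<forall>K \<in> ?A. P \<subseteq> K \<longrightarrow> K = P"
    by (rule bexE)
  then have P: "thick_tensor_ideal C P" "J \<subseteq> P" "s \<notin> P" by auto
  have max: "K = P" if "thick_tensor_ideal C K" "J \<subseteq> K" "s \<notin> K" "P \<subseteq> K" for K
    using bspec[OF maximal, of K] that by simp
  note PO = thick_tensor_ideal_subset[OF P(1)]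
  have gen: "s \<in> generated_ideal C (I \<union> P)" if I: "thick_tensor_ideal C I" "\<not> I \<subseteq> P" for I
  proof (rule ccontr)
    assume "s \<notin> generated_ideal C (I \<union> P)"
    moreover have "I \<union> P \<subseteq> generated_ideal C (I \<union> P)" by (rule generated_ideal_superset)
    moreover have "thick_tensor_ideal C (generated_ideal C (I \<union> P))"
      using thick_tensor_ideal_subset[OF I(1)] PO by (intro thick_tensor_ideal_generated) blast
    ultimately have "generated_ideal C (I \<union> P) = P" using P(2) by (intro max) auto
    then show False using I(2) generated_ideal_superset[of "I \<union> P" C] by blast
  qed
  have "I \<subseteq> P \<or> K \<subseteq> P"
    if I: "thick_tensor_ideal C I" and K: "thick_tensor_ideal C K"
      and IK: "{a \<odot> b | a b. a \<in> I \<and> b \<in> K} \<subseteq> P" for I K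
  proof (rule ccontr)
    assume n: "\<not> (I \<subseteq> P \<or> K \<subseteq> P)"
    have prod: "x \<odot> y \<in> P" if "x \<in> generated_ideal C (I \<union> P)" "y \<in> generated_ideal C (K \<union> P)" for x y
    proof (rule generated_ideal_tensor[OF P(1) _ _ _ _ that])
      show "I \<union> P \<subseteq> Obj C" "K \<union> P \<subseteq> Obj C"
        using PO thick_tensor_ideal_subset[OF I] thick_tensor_ideal_subset[OF K] by auto
      then show "a \<odot> b \<in> P" if "a \<in> I \<union> P" "b \<in> K \<union> P" for a b
        using that IK P(1) unfolding thick_tensor_ideal_def by blast
      show "X \<odot> b \<in> K \<union> P" if "X \<in> Obj C" "b \<in> K \<union> P" for X b
        using that K P(1) unfolding thick_tensor_ideal_def by blast
    qed
    have sI: "s \<in> generated_ideal C (I \<union> P)" and sK: "s \<in> generated_ideal C (K \<union> P)"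
      using gen[OF I] gen[OF K] n by blast+
    have gI: "thick_tensor_ideal C (generated_ideal C (I \<union> P))"
      using thick_tensor_ideal_subset[OF I] PO by (intro thick_tensor_ideal_generated) blast
    have "s \<odot> t \<odot> s \<in> P" if "t \<in> Obj C" for t
      using prod sK gI sI that unfolding thick_tensor_ideal_def by blast
    then show False
      using semiprime[OF P(1)] s P(3) unfolding semiprime_ideal_def by blast
  qed
  then have "prime_ideal C P"
    unfolding prime_ideal_def using P s by blast
  then show ?thesis using that P by blast
qed

lemma prime_ideal_iff_meet_prime:
  shows "prime_ideal C P \<longleftrightarrow> meet_prime (semiprime_lattice C) P"
proof -
  have car: "J \<in> carrier (semiprime_lattice C) \<longleftrightarrow> thick_tensor_ideal C J" for J
    using semiprime by (auto simp: semiprime_lattice_def semiprime_ideal_def)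
  have meet: "I \<sqinter>\<^bsub>semiprime_lattice C\<^esub> J = I \<inter> J" if "thick_tensor_ideal C I" "thick_tensor_ideal C J" for I J
    using semiprime that by (intro meet_semiprime_lattice)
  have "{a \<odot> b | a b. a \<in> I \<and> b \<in> J} \<subseteq> P \<longleftrightarrow> I \<inter> J \<subseteq> P"
    if P: "thick_tensor_ideal C P" and I: "thick_tensor_ideal C I" and J: "thick_tensor_ideal C J" for I J
  proof
    assume IJ: "I \<inter> J \<subseteq> P"
    have "a \<odot> b \<in> I \<inter> J" if "a \<in> I" "b \<in> J" for a b
      using I J that thick_tensor_ideal_subset[OF I] thick_tensor_ideal_subset[OF J]
      unfolding thick_tensor_ideal_def by blast
    then show "{a \<odot> b | a b. a \<in> I \<and> b \<in> J} \<subseteq> P" using IJ by blast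
  next
    assume IJ: "{a \<odot> b | a b. a \<in> I \<and> b \<in> J} \<subseteq> P"
    show "I \<inter> J \<subseteq> P"
    proof
      fix r assume r: "r \<in> I \<inter> J"
      then have "r \<odot> s \<odot> r \<in> P" if "s \<in> Obj C" for s
        using IJ I that unfolding thick_tensor_ideal_def by blast
      then show "r \<in> P"
        using semiprime[OF P] r thick_tensor_ideal_subset[OF I] unfolding semiprime_ideal_def by blast
    qed
  qed
  then show ?thesis
    unfolding prime_ideal_def meet_prime_def top_semiprime_lattice le_semiprime_lattice Ball_def car
    using meet by (intro conj_cong refl) (metis (no_types, lifting))
qed

section \<open>Comparison of the topologies\<close>

text \<open>A prime contains a set of objects exactly if it contains the ideal that they generate. Hence the
  opens can be indexed by sets of objects instead of ideals, and \<open>A = {s}\<close> gives the set \<open>D(s)\<close>.\<close>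

lemma openin_points:
  shows "openin (point_space (semiprime_lattice C)) U \<longleftrightarrow>
    (\<exists>A \<subseteq> Obj C. U = point_of (semiprime_lattice C) ` {P. prime_ideal C P \<and> \<not> A \<subseteq> P})"
proof -
  let ?L = "semiprime_lattice C"
  note L = complete_lattice_semiprime_lattice
  have car: "J \<in> carrier ?L \<longleftrightarrow> thick_tensor_ideal C J" for J
    using semiprime by (auto simp: semiprime_lattice_def semiprime_ideal_def)
  have pts: "CLat ?L two = point_of ?L ` {P. prime_ideal C P}"
    using bij_betw_point_of[OF L] prime_ideal_iff_meet_prime by (simp add: bij_betw_def)
  have U: "{p \<in> CLat ?L two. p l = True} = point_of ?L ` {P. prime_ideal C P \<and> \<not> l \<subseteq> P}"
    if l: "thick_tensor_ideal C l" for l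
  proof -
    have "point_of ?L P l \<longleftrightarrow> \<not> l \<subseteq> P" for P
      using l car by (simp add: point_of_def le_semiprime_lattice)
    then show ?thesis unfolding pts by blast
  qed
  have gen: "A \<subseteq> P \<longleftrightarrow> generated_ideal C A \<subseteq> P" if "prime_ideal C P" for A P
    using generated_ideal_superset[of A C] generated_ideal_least[OF prime_ideal_thick[OF that]] by blast
  show ?thesis
    unfolding openin_point_space[OF L]
  proof
    assume "\<exists>l \<in> carrier ?L. U = {p \<in> CLat ?L two. p l = True}"
    then obtain l where "thick_tensor_ideal C l" "U = {p \<in> CLat ?L two. p l = True}" using car by blast
    then show "\<exists>A \<subseteq> Obj C. U = point_of ?L ` {P. prime_ideal C P \<and> \<not> A \<subseteq> P}"
      using U[of l] thick_tensor_ideal_subset[of C l] by blast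
  next
    assume "\<exists>A \<subseteq> Obj C. U = point_of ?L ` {P. prime_ideal C P \<and> \<not> A \<subseteq> P}"
    then obtain A where A: "A \<subseteq> Obj C" "U = point_of ?L ` {P. prime_ideal C P \<and> \<not> A \<subseteq> P}" by blast
    have "{P. prime_ideal C P \<and> \<not> A \<subseteq> P} = {P. prime_ideal C P \<and> \<not> generated_ideal C A \<subseteq> P}"
      using gen by blast
    then have "U = {p \<in> CLat ?L two. p (generated_ideal C A) = True}"
      using A(2) U[OF thick_tensor_ideal_generated[OF A(1)]] by simp
    then show "\<exists>l \<in> carrier ?L. U = {p \<in> CLat ?L two. p l = True}"
      using car thick_tensor_ideal_generated[OF A(1)] by blast
  qed
qed

lemma topspace_points:
  shows "topspace (point_space (semiprime_lattice C)) = point_of (semiprime_lattice C) ` {P. prime_ideal C P}"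
    and "inj_on (point_of (semiprime_lattice C)) {P. prime_ideal C P}"
  using bij_betw_point_of[OF complete_lattice_semiprime_lattice] prime_ideal_iff_meet_prime
  by (simp_all add: bij_betw_def topspace_point_space[OF complete_lattice_semiprime_lattice])

text \<open>The opens of a cover come from sets \<open>A U\<close> of objects. If \<open>s\<close> were not in the ideal generated by all of
  them, a prime containing that ideal but not \<open>s\<close> would be left uncovered. Membership of \<open>s\<close> is witnessed
  by finitely many of the generators, and the finitely many \<open>U\<close> they come from already cover.\<close>

lemma compactin_points_avoiding:
  assumes s: "s \<in> Obj C"
  shows "compactin (point_space (semiprime_lattice C))
    (point_of (semiprime_lattice C) ` {P. prime_ideal C P \<and> s \<notin> P})"
  unfolding compactin_def
proof (intro conjI allI impI)
  let ?L = "semiprime_lattice C" let ?pt = "point_of ?L"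
  let ?K = "?pt ` {P. prime_ideal C P \<and> s \<notin> P}"
  show "?K \<subseteq> topspace (point_space ?L)" unfolding topspace_points by blast
  fix \<U> assume "Ball \<U> (openin (point_space ?L)) \<and> ?K \<subseteq> \<Union>\<U>"
  then have op: "Ball \<U> (openin (point_space ?L))" and cover: "?K \<subseteq> \<Union>\<U>" by auto
  have "\<exists>A \<subseteq> Obj C. U = ?pt ` {P. prime_ideal C P \<and> \<not> A \<subseteq> P}" if "U \<in> \<U>" for U
    using op that openin_points by blast
  then obtain A where A: "\<And>U. U \<in> \<U> \<Longrightarrow> A U \<subseteq> Obj C"
    "\<And>U. U \<in> \<U> \<Longrightarrow> U = ?pt ` {P. prime_ideal C P \<and> \<not> A U \<subseteq> P}" by metis
  have mem: "?pt P \<in> U \<longleftrightarrow> \<not> A U \<subseteq> P" if "U \<in> \<U>" "prime_ideal C P" for U P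
  proof -
    have "?pt P \<in> ?pt ` {P. prime_ideal C P \<and> \<not> A U \<subseteq> P} \<longleftrightarrow> P \<in> {P. prime_ideal C P \<and> \<not> A U \<subseteq> P}"
      using that(2) by (intro inj_on_image_mem_iff[OF topspace_points(2)]) auto
    then show ?thesis using A(2)[OF that(1)] that(2) by simp
  qed
  have AO: "\<Union>(A ` \<U>) \<subseteq> Obj C" using A(1) by blast
  have "s \<in> generated_ideal C (\<Union>(A ` \<U>))"
  proof (rule ccontr)
    assume "s \<notin> generated_ideal C (\<Union>(A ` \<U>))"
    with prime_ideal_separation[OF thick_tensor_ideal_generated[OF AO] s]
    obtain P where P: "prime_ideal C P" "generated_ideal C (\<Union>(A ` \<U>)) \<subseteq> P" "s \<notin> P" by blast
    then obtain U where "U \<in> \<U>" "?pt P \<in> U" using cover by blast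
    then show False using mem[OF _ P(1)] P(2) generated_ideal_superset[of "\<Union>(A ` \<U>)" C] by blast
  qed
  from generated_ideal_finitary[OF AO this] obtain F where
    F: "finite F" "F \<subseteq> \<Union>(A ` \<U>)" "s \<in> generated_ideal C F" by blast
  then obtain \<F> where \<F>: "finite \<F>" "\<F> \<subseteq> \<U>" "F \<subseteq> \<Union>(A ` \<F>)"
    using finite_subset_Union[of F "A ` \<U>"] by (metis finite_subset_image)
  have "?K \<subseteq> \<Union>\<F>"
  proof
    fix p assume "p \<in> ?K"
    then obtain P where P: "prime_ideal C P" "s \<notin> P" "p = ?pt P" by blast
    then have "\<not> F \<subseteq> P" using generated_ideal_least[OF prime_ideal_thick[OF P(1)]] F(3) by blast
    then obtain U where "U \<in> \<F>" "\<not> A U \<subseteq> P" using \<F>(3) by blast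
    then show "p \<in> \<Union>\<F>" using mem[OF _ P(1)] \<F>(2) P(3) by blast
  qed
  then show "\<exists>\<F>. finite \<F> \<and> \<F> \<subseteq> \<U> \<and> ?K \<subseteq> \<Union>\<F>" using \<F> by blast
qed

text \<open>The open set given by \<open>A\<close> is the union of the sets \<open>D(s)\<close> with \<open>s \<in> A\<close>, and finitely many of them suffice.\<close>

lemma compact_open_points:
  assumes "openin (point_space (semiprime_lattice C)) K" "compactin (point_space (semiprime_lattice C)) K"
  shows "\<exists>F \<subseteq> Obj C. finite F \<and> K = point_of (semiprime_lattice C) ` {P. prime_ideal C P \<and> \<not> F \<subseteq> P}"
proof -
  let ?L = "semiprime_lattice C" let ?pt = "point_of ?L"
  let ?D = "\<lambda>s. ?pt ` {P. prime_ideal C P \<and> s \<notin> P}"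
  obtain A where A: "A \<subseteq> Obj C" "K = ?pt ` {P. prime_ideal C P \<and> \<not> A \<subseteq> P}"
    using iffD1[OF openin_points assms(1)] by blast
  have "openin (point_space ?L) (?D s)" if "s \<in> A" for s
    unfolding openin_points using that A(1) by (intro exI[of _ "{s}"]) auto
  moreover have KA: "K = \<Union>(?D ` A)" unfolding A(2) by blast
  ultimately obtain \<F> where \<F>: "finite \<F>" "\<F> \<subseteq> ?D ` A" "K \<subseteq> \<Union>\<F>"
    using compactinD[OF assms(2), of "?D ` A"] by blast
  from finite_subset_image[OF \<F>(1,2)]
  obtain F where F: "F \<subseteq> A" "finite F" "\<F> = ?D ` F" by blast
  have "K = \<Union>(?D ` F)" using \<F>(3) F KA by blast
  also have "\<dots> = ?pt ` {P. prime_ideal C P \<and> \<not> F \<subseteq> P}" by blast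
  finally show ?thesis using F A(1) by blast
qed

text \<open>A subbasic open set of the dual topology is the complement of a finite union of sets \<open>D(s)\<close>, so it
  pulls back to a finite intersection of open sets \<open>{P. s \<in> P}\<close>. Conversely, the open sets of the spectrum are
  unions of sets \<open>{P. s \<in> P}\<close>, which are complements of the quasi-compact opens \<open>D(s)\<close>.\<close>

lemma homeomorphic_map_Spc_nc:
  shows "homeomorphic_map (Spc_nc C) (dual_space (point_space (semiprime_lattice C)))
    (point_of (semiprime_lattice C))"
proof (rule bijective_open_imp_homeomorphic_map)
  let ?L = "semiprime_lattice C" let ?pt = "point_of ?L" let ?X = "point_space ?L"
  note pts = topspace_points
  have mem: "?pt P \<in> ?pt ` {P. prime_ideal C P \<and> Q P} \<longleftrightarrow> Q P" if "prime_ideal C P" for P Q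
  proof -
    have "?pt P \<in> ?pt ` {P. prime_ideal C P \<and> Q P} \<longleftrightarrow> P \<in> {P. prime_ideal C P \<and> Q P}"
      using that by (intro inj_on_image_mem_iff[OF pts(2)]) auto
    then show ?thesis using that by simp
  qed
  show "?pt ` topspace (Spc_nc C) = topspace (dual_space ?X)"
    by (simp add: topspace_Spc_nc topspace_dual_space pts)
  show "inj_on ?pt (topspace (Spc_nc C))"
    by (simp add: topspace_Spc_nc pts)
  show "continuous_map (Spc_nc C) (dual_space ?X) ?pt"
  proof (rule continuous_map_dual_space)
    show "?pt ` topspace (Spc_nc C) \<subseteq> topspace ?X" by (simp add: topspace_Spc_nc pts)
    fix K assume K: "openin ?X K" "compactin ?X K"
    then obtain F where F: "F \<subseteq> Obj C" "finite F" "K = ?pt ` {P. prime_ideal C P \<and> \<not> F \<subseteq> P}"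
      using compact_open_points[OF K] by blast
    have "openin (Spc_nc C) {P. prime_ideal C P \<and> s \<in> P}" if "s \<in> F" for s
      unfolding openin_Spc_nc using that F(1) by (intro exI[of _ "{s}"]) auto
    then have "openin (Spc_nc C) (topspace (Spc_nc C) \<inter> \<Inter>((\<lambda>s. {P. prime_ideal C P \<and> s \<in> P}) ` F))"
      using F(2) by (intro openin_Int_Inter) auto
    moreover have "{P \<in> topspace (Spc_nc C). ?pt P \<notin> K} =
      topspace (Spc_nc C) \<inter> \<Inter>((\<lambda>s. {P. prime_ideal C P \<and> s \<in> P}) ` F)"
      unfolding F(3) topspace_Spc_nc using mem[of _ "\<lambda>P. \<not> F \<subseteq> P"] by blast
    ultimately show "openin (Spc_nc C) {P \<in> topspace (Spc_nc C). ?pt P \<notin> K}" by simp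
  qed
  show "open_map (Spc_nc C) (dual_space ?X) ?pt"
    unfolding open_map_def
  proof (intro allI impI)
    fix U assume "openin (Spc_nc C) U"
    then obtain S where S: "S \<subseteq> Obj C" "U = {P. prime_ideal C P \<and> P \<inter> S \<noteq> {}}"
      unfolding openin_Spc_nc by blast
    have "?pt ` {P. prime_ideal C P \<and> s \<in> P} = topspace ?X - ?pt ` {P. prime_ideal C P \<and> s \<notin> P}" for s
    proof -
      have "{P. prime_ideal C P \<and> s \<in> P} = {P. prime_ideal C P} - {P. prime_ideal C P \<and> s \<notin> P}" by blast
      then show ?thesis
        unfolding pts(1) by (simp only:) (rule inj_on_image_set_diff[OF pts(2)]; blast)
    qed
    moreover have "openin ?X (?pt ` {P. prime_ideal C P \<and> s \<notin> P})" if "s \<in> S" for s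
      unfolding openin_points using that S(1) by (intro exI[of _ "{s}"]) auto
    ultimately have "openin (dual_space ?X) (?pt ` {P. prime_ideal C P \<and> s \<in> P})" if "s \<in> S" for s
      using openin_dual_space[OF _ compactin_points_avoiding[of s]] that S(1) by (metis subsetD)
    then have "openin (dual_space ?X) (\<Union>s \<in> S. ?pt ` {P. prime_ideal C P \<and> s \<in> P})"
      by (intro openin_Union) auto
    moreover have "?pt ` U = (\<Union>s \<in> S. ?pt ` {P. prime_ideal C P \<and> s \<in> P})"
      unfolding S(2) by blast
    ultimately show "openin (dual_space ?X) (?pt ` U)" by simp
  qed
qed

end

theorem theorem6p4p5:
  fixes R :: "('o, 'm) monoidal_triangulated_data"
  assumes "monoidal_triangulated_category R"
    and "\<And>J. thick_tensor_ideal R J \<Longrightarrow> semiprime_ideal R J"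
  shows "{P. prime_ideal R P} = {P. meet_prime (semiprime_lattice R) P}
    \<and> bij_betw (point_of (semiprime_lattice R))
        {P. meet_prime (semiprime_lattice R) P} (CLat (semiprime_lattice R) two)
    \<and> homeomorphic_map (Spc_nc R) (dual_space (point_space (semiprime_lattice R)))
        (point_of (semiprime_lattice R))
    \<and> homeomorphic_map (dual_space (point_space (semiprime_lattice R)))
        (dual_space (Spec (Omega (semiprime_lattice R))))
        (point_eval (point_space (semiprime_lattice R)))"
proof (intro conjI)
  interpret all_ideals_semiprime R
    using assms by (intro all_ideals_semiprime.intro all_ideals_semiprime_axioms.intro)
  note L = complete_lattice_semiprime_lattice
  show "{P. prime_ideal R P} = {P. meet_prime (semiprime_lattice R) P}"
    using prime_ideal_iff_meet_prime by simp
  show "bij_betw (point_of (semiprime_lattice R))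
        {P. meet_prime (semiprime_lattice R) P} (CLat (semiprime_lattice R) two)"
    by (rule bij_betw_point_of[OF L])
  show "homeomorphic_map (Spc_nc R) (dual_space (point_space (semiprime_lattice R)))
        (point_of (semiprime_lattice R))"
    by (rule homeomorphic_map_Spc_nc)
  show "homeomorphic_map (dual_space (point_space (semiprime_lattice R)))
        (dual_space (Spec (Omega (semiprime_lattice R))))
        (point_eval (point_space (semiprime_lattice R)))"
    unfolding Omega_def by (rule homeomorphic_map_dual_space[OF homeomorphic_map_point_eval[OF L]])
qed

end
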